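(* Let $\mathcal{L}$ be a real closed valued field with convex valuation and value group $\Gamma$, and let $A\in {\operatorname{\mathsf{TPD}}}_n(\mathbb{S}_{\max}^{\vee})$. Let ${\bf A}$ be a symmetric positive definite matrix over $\mathcal{L}$ such that $\mathrm{sv}({\bf A})= A$. Then, the signed valuations of the eigenvalues of ${\bf A}$, counted with multiplicities, coincide with the algebraic $\mathbb{S}_{\max}$-eigenvalues of $A$, that is the diagonal entries of $A$.
   Context: $\Gamma$ is a divisible totally ordered abelian group and $\mathbb{S}_{\max}=\mathbb{S}_{\max}(\Gamma)$ the symmetrized tropical semiring, with zero $\mathbf{0}$, unit $\mathbf{1}$, minus operator $\ominus$; $\mathbb{S}_{\max}^\vee$ (resp. $\mathbb{S}_{\max}^\oplus$) is the set of signed elements (resp. positive elements and $\mathbf{0}$), and $a\,\nabla\, b$ iff $a\ominus b$ is balanced; $a<b$ iff $b\ominus a\in\mathbb{S}_{\max}^\oplus\setminus\{\mathbf{0}\}$. $A\in{\operatorname{\mathsf{TPD}}}_n(\mathbb{S}_{\max}^\vee)$ means $A=(a_{ij})$ is symmetric with entries in $\mathbb{S}_{\max}^\vee$ and $\mathbf{0}<x^TAx$ for all nonzero $x\in(\mathbb{S}_{\max}^\vee)^n$ (equivalently $\mathbf{0}<a_{ii}$, $a_{ij}^2<a_{ii}a_{jj}$ for $i\ne j$). For an ordered field $\mathcal{L}$ with convex valuation $\mathrm v:\mathcal{L}\to\Gamma\cup\{\bot\}$, the signed valuation is $\mathrm{sv}(b)=\mathrm{sgn}(b)\odot\mathrm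 v(b)\in\mathbb{S}_{\max}^\vee$, where $\mathrm{sgn}(b)$ is $\mathbf{1}$, $\ominus\mathbf{1}$ or $\mathbf{0}$ according as $b>0$, $b<0$ or $b=0$; it is applied entrywise to matrices. The algebraic $\mathbb{S}_{\max}$-eigenvalues of $A$ are the $\gamma\in\mathbb{S}_{\max}^\vee$ with $\det(\gamma I\ominus A)\,\nabla\,\mathbf{0}$, counted with multiplicity as roots of the characteristic polynomial $\det(\mathsf{X} I\ominus A)$ (multiplicity $\mathrm{mult}_r(P)=1+\max\{\mathrm{mult}_r(Q): P\,\nabla\,(\mathsf{X}\ominus r)Q\}$ for a root $r$, $Q$ ranging over polynomials with signed coefficients). *)

theory Defs
  imports "Jordan_Normal_Form.Char_Poly" "HOL-Computational_Algebra.Polynomial"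
    "HOL-Combinatorics.Permutations"
begin

definition divisible_group :: "'g::linordered_ab_group_add itself \<Rightarrow> bool" where
  "divisible_group _ = (\<forall>(x::'g) (n::nat). n > 0 \<longrightarrow> (\<exists>y::'g. (\<Sum>i<n. y) = x))"

text \<open>SZero is the zero, SPos a is the positive element a (a in Gamma),
  SNeg a is the element minus a, SBal a is the balanced element a dot.\<close>
datatype 'g smax = SZero | SPos 'g | SNeg 'g | SBal 'g

fun smod :: "'g smax \<Rightarrow> 'g" where
  "smod SZero = undefined" | "smod (SPos a) = a" | "smod (SNeg a) = a" | "smod (SBal a) = a"

fun smax_add :: "'g::linorder smax \<Rightarrow> 'g smax \<Rightarrow> 'g smax" where
  "smax_add SZero y = y"
| "smax_add x SZero = x"
| "smax_add x y =
     (if smod y < smod x then x else if smod x < smod y then y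
      else if x = y then x else SBal (smod x))"

fun smax_mul :: "'g::ordered_ab_group_add smax \<Rightarrow> 'g smax \<Rightarrow> 'g smax" where
  "smax_mul SZero y = SZero"
| "smax_mul x SZero = SZero"
| "smax_mul (SPos a) (SPos b) = SPos (a + b)"
| "smax_mul (SPos a) (SNeg b) = SNeg (a + b)"
| "smax_mul (SNeg a) (SPos b) = SNeg (a + b)"
| "smax_mul (SNeg a) (SNeg b) = SPos (a + b)"
| "smax_mul x y = SBal (smod x + smod y)"

fun smax_neg :: "'g smax \<Rightarrow> 'g smax" where
  "smax_neg SZero = SZero" | "smax_neg (SPos a) = SNeg a"
| "smax_neg (SNeg a) = SPos a" | "smax_neg (SBal a) = SBal a"

instantiation smax :: (linordered_ab_group_add) comm_semiring_1
begin
definition "zero_smax = SZero"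
definition "one_smax = SPos 0"
definition "plus_smax = smax_add"
definition "times_smax = smax_mul"
instance
proof
  fix a b c :: "'a smax"
  show "a + b + c = a + (b + c)" unfolding plus_smax_def
    by (cases a; cases b; cases c) auto
  show "a + b = b + a" unfolding plus_smax_def
    by (cases a; cases b) auto
  show "0 + a = a" unfolding plus_smax_def zero_smax_def by simp
  show "a * b * c = a * (b * c)" unfolding times_smax_def
    by (cases a; cases b; cases c) (auto simp: add.assoc)
  show "a * b = b * a" unfolding times_smax_def
    by (cases a; cases b) (auto simp: add.commute)
  show "1 * a = a" unfolding times_smax_def one_smax_def by (cases a) auto
  show "0 * a = 0" unfolding times_smax_def zero_smax_def by simp
  show "a * 0 = 0" unfolding times_smax_def zero_smax_def by (cases a) auto
  show "(a + b) * c = a * c + b * c" unfolding times_smax_def plus_smax_def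
    by (cases a; cases b; cases c) auto
  show "(0::'a smax) \<noteq> 1" unfolding zero_smax_def one_smax_def by simp
qed
end

definition smax_balanced :: "'g smax \<Rightarrow> bool" where
  "smax_balanced x = (x = SZero \<or> (\<exists>a. x = SBal a))"

definition smax_signed :: "'g smax \<Rightarrow> bool" where
  "smax_signed x = (\<not> (\<exists>a. x = SBal a))"

definition smax_pos_or_zero :: "'g smax \<Rightarrow> bool" where
  "smax_pos_or_zero x = (x = SZero \<or> (\<exists>a. x = SPos a))"

definition smax_minus :: "'g::linordered_ab_group_add smax \<Rightarrow> 'g smax \<Rightarrow> 'g smax" where
  "smax_minus a b = a + smax_neg b"

definition smax_bal :: "'g::linordered_ab_group_add smax \<Rightarrow> 'g smax \<Rightarrow> bool" where
  "smax_bal a b = smax_balanced (smax_minus a b)"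

definition smax_less :: "'g::linordered_ab_group_add smax \<Rightarrow> 'g smax \<Rightarrow> bool" where
  "smax_less a b = (smax_pos_or_zero (smax_minus b a) \<and> smax_minus b a \<noteq> SZero)"

definition smax_TPD :: "nat \<Rightarrow> 'g::linordered_ab_group_add smax mat \<Rightarrow> bool" where
  "smax_TPD n A = (A \<in> carrier_mat n n \<and> A\<^sup>T = A \<and>
     (\<forall>i<n. \<forall>j<n. smax_signed (A $$ (i, j))) \<and>
     (\<forall>x::nat \<Rightarrow> 'g smax. (\<forall>i<n. smax_signed (x i)) \<and> (\<exists>i<n. x i \<noteq> 0) \<longrightarrow>
        smax_less 0 (\<Sum>i<n. \<Sum>j<n. x i * A $$ (i, j) * x j)))"

definition sym_det :: "('b::comm_semiring_1 \<Rightarrow> 'b) \<Rightarrow> nat \<Rightarrow> (nat \<Rightarrow> nat \<Rightarrow> 'b) \<Rightarrow> 'b" where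
  "sym_det ng n M = (\<Sum>p\<in>{p. p permutes {..<n}}.
      (if evenperm p then 1 else ng 1) * (\<Prod>i<n. M i (p i)))"

definition smax_poly_neg :: "'g::linordered_ab_group_add smax poly \<Rightarrow> 'g smax poly" where
  "smax_poly_neg P = map_poly smax_neg P"

definition smax_det_shift :: "'g::linordered_ab_group_add smax \<Rightarrow> 'g smax mat \<Rightarrow> 'g smax" where
  "smax_det_shift \<gamma> A = sym_det smax_neg (dim_row A)
     (\<lambda>i j. smax_minus (if i = j then \<gamma> else 0) (A $$ (i, j)))"

definition smax_char_poly :: "'g::linordered_ab_group_add smax mat \<Rightarrow> 'g smax poly" where
  "smax_char_poly A = sym_det smax_poly_neg (dim_row A)
     (\<lambda>i j. (if i = j then [:0, 1:] else 0) + [: smax_neg (A $$ (i, j)) :])"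

definition smax_poly_bal :: "'g::linordered_ab_group_add smax poly \<Rightarrow> 'g smax poly \<Rightarrow> bool" where
  "smax_poly_bal P R = (\<forall>k. smax_bal (coeff P k) (coeff R k))"

definition smax_poly_signed :: "'g::linordered_ab_group_add smax poly \<Rightarrow> bool" where
  "smax_poly_signed Q = (\<forall>k. smax_signed (coeff Q k))"

text \<open>mult_ge m P r: r has multiplicity at least m as a root of P, following the recursive
  definition mult_r(P) = 1 + max { mult_r(Q) : P balances (X minus r) Q, Q signed }.\<close>
primrec smax_mult_ge :: "nat \<Rightarrow> 'g::linordered_ab_group_add smax poly \<Rightarrow> 'g smax \<Rightarrow> bool" where
  "smax_mult_ge 0 P r = True"
| "smax_mult_ge (Suc m) P r = (\<exists>Q. smax_poly_signed Q \<and>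
      smax_poly_bal P ([: smax_neg r, 1 :] * Q) \<and> smax_mult_ge m Q r)"

definition smax_root_mult :: "'g::linordered_ab_group_add smax poly \<Rightarrow> 'g smax \<Rightarrow> nat" where
  "smax_root_mult P r = (GREATEST m. smax_mult_ge m P r)"

definition smax_alg_eig_mult :: "'g::linordered_ab_group_add smax mat \<Rightarrow> 'g smax \<Rightarrow> nat" where
  "smax_alg_eig_mult A \<gamma> =
     (if smax_signed \<gamma> \<and> smax_bal (smax_det_shift \<gamma> A) 0
      then smax_root_mult (smax_char_poly A) \<gamma> else 0)"

definition real_closed_field :: "'a::linordered_field itself \<Rightarrow> bool" where
  "real_closed_field _ = ((\<forall>x::'a. 0 \<le> x \<longrightarrow> (\<exists>y. y * y = x)) \<and>
     (\<forall>p::'a poly. odd (degree p) \<longrightarrow> (\<exists>x. poly p x = 0)))"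

text \<open>A (max-plus convention) valuation v : L -> Gamma union {bot}, None standing for bot,
  which is convex and has value group Gamma (surjective onto Gamma).\<close>
definition convex_valuation :: "('a::linordered_field \<Rightarrow> 'g::linordered_ab_group_add option) \<Rightarrow> bool" where
  "convex_valuation v =
    ((\<forall>x. v x = None \<longleftrightarrow> x = 0) \<and>
     (\<forall>x y. x \<noteq> 0 \<longrightarrow> y \<noteq> 0 \<longrightarrow> v (x * y) = Some (the (v x) + the (v y))) \<and>
     (\<forall>x y. x + y \<noteq> 0 \<longrightarrow> x \<noteq> 0 \<longrightarrow> y \<noteq> 0 \<longrightarrow>
        the (v (x + y)) \<le> max (the (v x)) (the (v y))) \<and>
     (\<forall>x y. x \<noteq> 0 \<longrightarrow> \<bar>x\<bar> \<le> \<bar>y\<bar> \<longrightarrow> the (v x) \<le> the (v y)) \<and>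
     (\<forall>g. \<exists>x. v x = Some g))"

definition signed_val :: "('a::linordered_field \<Rightarrow> 'g option) \<Rightarrow> 'a \<Rightarrow> 'g smax" where
  "signed_val v b = (if b > 0 then SPos (the (v b)) else if b < 0 then SNeg (the (v b)) else SZero)"

definition pos_def_mat :: "nat \<Rightarrow> 'a::linordered_field mat \<Rightarrow> bool" where
  "pos_def_mat n A = (A \<in> carrier_mat n n \<and> A\<^sup>T = A \<and>
     (\<forall>x \<in> carrier_vec n. x \<noteq> 0\<^sub>v n \<longrightarrow> 0 < x \<bullet> (A *\<^sub>v x)))"

end

theory Submission
  imports Defs "HOL-Algebra.Algebraic_Closure_Type" "HOL-Computational_Algebra.Polynomial_FPS"
begin

text \<open>
  Tropical positive definiteness forces \<open>a\<^sub>i\<^sub>j\<^sup>2 < a\<^sub>i\<^sub>i a\<^sub>j\<^sub>j\<close>, so in the tropical characteristic polynomial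
  every permutation other than the identity is absorbed and the polynomial is the product of the
  \<open>X \<ominus> a\<^sub>i\<^sub>i\<close>. The multiplicity of a positive \<open>\<gamma>\<close> as a root is at most the width of the edge of slope
  \<open>\<gamma>\<close> of the Newton polygon, since each division by \<open>X \<ominus> \<gamma>\<close> shortens this edge by exactly one; for a
  product of factors \<open>X \<ominus> d\<close> with \<open>d\<close> positive it is the number of \<open>d\<close> equal to \<open>\<gamma>\<close>, so such a product
  determines its factors.

  Over the real closed field the characteristic polynomial of a symmetric matrix splits, by
  Laplace's proof of the fundamental theorem of algebra inside the algebraic closure, and positive
  definiteness makes its roots \<open>\<lambda>\<close> positive. The coefficients of the product of the \<open>X - \<lambda>\<close> and of the
  characteristic polynomial computed from the entries therefore have as signed valuations the
  coefficients of the products of the \<open>X \<ominus> sv \<lambda>\<close> and of the \<open>X \<ominus> a\<^sub>i\<^sub>i\<close>, no cancellation being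
  possible. These two products are equal, hence so are their factors.
\<close>

hide_const (open) Polynomials.degree Polynomials.lead_coeff Module.smult UnivPoly.coeff UnivPoly.monom

section \<open>Domination in the symmetrized tropical semiring\<close>

lemmas smax_ops = plus_smax_def times_smax_def zero_smax_def one_smax_def

text \<open>\<open>smod\<close> is unspecified at \<open>SZero\<close>, so the zero is treated
  apart: everything dominates it, itself included, and \<open>smax_dom_mult\<close> then also holds
  for \<open>z = 0\<close>.\<close>

definition smax_dom :: "'g::linorder smax \<Rightarrow> 'g smax \<Rightarrow> bool" where
  "smax_dom y x \<longleftrightarrow> y = SZero \<or> (x \<noteq> SZero \<and> smod y < smod x)"

lemma smax_dom_absorb: "smax_dom y x \<Longrightarrow> x + y = (x :: 'g::linordered_ab_group_add smax)"
  by (cases x; cases y) (auto simp: smax_dom_def smax_ops)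

text \<open>Addition never lowers the modulus: opposite elements of equal modulus give a balanced
  element of that modulus instead of cancelling.\<close>

lemma smax_dom_add: "smax_dom y x \<Longrightarrow> smax_dom y (x + z :: 'g::linordered_ab_group_add smax)"
  by (cases x; cases y; cases z) (auto simp: smax_dom_def smax_ops)

lemma smax_dom_mult: "smax_dom y x \<Longrightarrow> smax_dom (y * z) (x * z :: 'g::linordered_ab_group_add smax)"
  by (cases x; cases y; cases z) (auto simp: smax_dom_def smax_ops)

lemma smax_mult_eq_0_iff: "x * y = 0 \<longleftrightarrow> x = 0 \<or> y = (0 :: 'g::linordered_ab_group_add smax)"
  by (cases x; cases y) (auto simp: smax_ops)

lemma smax_neg_eq_0_iff [simp]: "smax_neg x = 0 \<longleftrightarrow> x = (0 :: 'g::linordered_ab_group_add smax)"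
  by (cases x) (auto simp: smax_ops)

lemma smod_mult: "x \<noteq> 0 \<Longrightarrow> y \<noteq> 0 \<Longrightarrow> smod (x * y) = smod x + smod (y :: 'g::linordered_ab_group_add smax)"
  by (cases x; cases y) (auto simp: smax_ops)

lemma smod_neg [simp]: "x \<noteq> 0 \<Longrightarrow> smod (smax_neg x) = smod (x :: 'g::linordered_ab_group_add smax)"
  by (cases x) (auto simp: smax_ops)

lemma smod_prod:
  fixes f :: "'i \<Rightarrow> 'g::linordered_ab_group_add smax"
  assumes "finite S" "\<And>i. i \<in> S \<Longrightarrow> f i \<noteq> 0"
  shows "prod f S \<noteq> 0 \<and> smod (prod f S) = (\<Sum>i\<in>S. smod (f i))"
  using assms
proof (induction S rule: finite_induct)
  case empty
  show ?case by (simp add: smax_ops)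
next
  case (insert x F)
  then show ?case by (auto simp: smax_mult_eq_0_iff smod_mult)
qed

lemma prod_const_poly: "(\<Prod>i\<in>S. [:f i:]) = [:\<Prod>i\<in>S. f i :: 'a::comm_semiring_1:]"
  by (induction S rule: infinite_finite_induct) (auto simp: one_pCons mult.commute)

lemma sum_absorb:
  assumes "finite S" "\<And>s. s \<in> S \<Longrightarrow> a + f s = (a :: 'a::comm_monoid_add)"
  shows "a + sum f S = a"
  using assms by (induction S rule: finite_induct) (auto simp: add.assoc[symmetric])

text \<open>Summing \<open>2|a\<^sub>i\<^sub>\<sigma>\<^sub>i| < d\<^sub>i + d\<^sub>\<sigma>\<^sub>i\<close> over the moved points counts every diagonal entry twice.\<close>
lemma smax_dom_perm_prod:
  fixes a :: "nat \<Rightarrow> nat \<Rightarrow> 'g::linordered_ab_group_add smax"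
  assumes p: "p permutes {..<n}" and ne: "p \<noteq> id"
    and d: "\<And>i. i < n \<Longrightarrow> a i i \<noteq> 0"
    and off: "\<And>i j. i < n \<Longrightarrow> j < n \<Longrightarrow> i \<noteq> j \<Longrightarrow> a i j \<noteq> 0 \<Longrightarrow>
        smod (a i j) + smod (a i j) < smod (a i i) + smod (a j j)"
    and s: "s \<noteq> 0" "smod s = 0"
  defines "G \<equiv> {i. i < n \<and> p i \<noteq> i}"
  shows "smax_dom (s * (\<Prod>i\<in>G. smax_neg (a i (p i)))) (\<Prod>i\<in>G. smax_neg (a i i))"
proof (cases "\<exists>i\<in>G. a i (p i) = 0")
  case True
  then have "(\<Prod>i\<in>G. smax_neg (a i (p i))) = 0"
    by (intro prod_zero) (auto simp: G_def)
  then show ?thesis by (simp add: smax_dom_def) (simp add: smax_ops)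
next
  case False
  have fin: "finite G" by (simp add: G_def)
  have pin: "i \<in> G \<Longrightarrow> i < n \<and> p i < n \<and> p i \<noteq> i" for i
    using permutes_in_image[OF p] by (auto simp: G_def)
  have inj: "inj p" using p by (rule permutes_inj)
  have img: "p ` G = G"
  proof -
    have "p ` G \<subseteq> G" using pin inj by (auto simp: G_def dest: injD)
    then show ?thesis using fin inj by (metis card_image card_subset_eq inj_on_subset subset_UNIV)
  qed
  have Gne: "G \<noteq> {}"
  proof
    assume "G = {}"
    then have "p i = i" for i
      using permutes_not_in[OF p, of i] by (auto simp: G_def)
    then show False using ne by auto
  qed
  have nz1: "(\<Prod>i\<in>G. smax_neg (a i (p i))) \<noteq> 0 \<and>
      smod (\<Prod>i\<in>G. smax_neg (a i (p i))) = (\<Sum>i\<in>G. smod (smax_neg (a i (p i))))"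
    using False by (intro smod_prod fin) auto
  have nz2: "(\<Prod>i\<in>G. smax_neg (a i i)) \<noteq> 0 \<and>
      smod (\<Prod>i\<in>G. smax_neg (a i i)) = (\<Sum>i\<in>G. smod (smax_neg (a i i)))"
    using d pin by (intro smod_prod fin) auto
  have e1: "(\<Sum>i\<in>G. smod (smax_neg (a i (p i)))) = (\<Sum>i\<in>G. smod (a i (p i)))"
    using False by (intro sum.cong) auto
  have e2: "(\<Sum>i\<in>G. smod (smax_neg (a i i))) = (\<Sum>i\<in>G. smod (a i i))"
    using d pin by (intro sum.cong) auto
  let ?S = "\<Sum>i\<in>G. smod (a i (p i))" and ?D = "\<Sum>i\<in>G. smod (a i i)"
  have "?S + ?S = (\<Sum>i\<in>G. smod (a i (p i)) + smod (a i (p i)))" by (simp add: sum.distrib)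
  also have "\<dots> < (\<Sum>i\<in>G. smod (a i i) + smod (a (p i) (p i)))"
  proof (rule sum_strict_mono[OF fin Gne])
    fix i assume i: "i \<in> G"
    then show "smod (a i (p i)) + smod (a i (p i)) < smod (a i i) + smod (a (p i) (p i))"
      using off[of i "p i"] pin[OF i] False by auto
  qed
  also have "\<dots> = ?D + (\<Sum>i\<in>G. smod (a (p i) (p i)))" by (simp add: sum.distrib)
  also have "(\<Sum>i\<in>G. smod (a (p i) (p i))) = (\<Sum>i\<in>p ` G. smod (a i i))"
    using inj by (subst sum.reindex) (auto intro: inj_on_subset)
  also have "\<dots> = ?D" by (simp only: img)
  \<comment> \<open>By now \<open>?S + ?S < ?D + ?D\<close>, which \<open>?D \<le> ?S\<close> added
    to itself would contradict.\<close>
  finally have "?S < ?D" by (meson add_mono leD le_less_linear)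
  then show ?thesis
    using nz1 nz2 e1 e2 s by (auto simp: smax_dom_def smod_mult zero_smax_def[symmetric])
qed

text \<open>A permutation other than the identity contributes \<open>c\<close> times the product of
  the \<open>?L i\<close> over its fixed points. In the term of the identity the moved points
  contribute \<open>prod ?L G\<close>, whose constant coefficient alone dominates \<open>c\<close>;
  hence absorption holds coefficient by coefficient.\<close>

theorem smax_char_poly_eq_prod:
  fixes A :: "'g::linordered_ab_group_add smax mat"
  assumes A: "A \<in> carrier_mat n n"
    and d: "\<And>i. i < n \<Longrightarrow> A $$ (i, i) \<noteq> 0"
    and off: "\<And>i j. i < n \<Longrightarrow> j < n \<Longrightarrow> i \<noteq> j \<Longrightarrow> A $$ (i, j) \<noteq> 0 \<Longrightarrow>
        smod (A $$ (i, j)) + smod (A $$ (i, j)) < smod (A $$ (i, i)) + smod (A $$ (j, j))"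
  shows "smax_char_poly A = (\<Prod>i<n. [:smax_neg (A $$ (i, i)), 1:])"
proof -
  let ?L = "\<lambda>i. [:smax_neg (A $$ (i, i)), 1:]"
  let ?P = "\<Prod>i<n. ?L i"
  define T where "T = (\<lambda>p. (if evenperm p then 1 else smax_poly_neg 1) *
      (\<Prod>i<n. (if i = p i then [:0, 1:] else 0) + [:smax_neg (A $$ (i, p i)):]))"
  have "smax_char_poly A = (\<Sum>p\<in>{p. p permutes {..<n}}. T p)"
    using A by (simp add: smax_char_poly_def sym_det_def T_def)
  also have "\<dots> = T id + (\<Sum>p\<in>{p. p permutes {..<n}} - {id}. T p)"
    by (intro sum.remove) (auto simp: finite_permutations permutes_id)
  also have "T id = ?P" by (simp add: T_def)
  also have "?P + (\<Sum>p\<in>{p. p permutes {..<n}} - {id}. T p) = ?P"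
  proof (rule sum_absorb)
    show "finite ({p. p permutes {..<n}} - {id})" by (simp add: finite_permutations)
    fix p assume "p \<in> {p. p permutes {..<n}} - {id}"
    then have p: "p permutes {..<n}" and ne: "p \<noteq> id" by auto
    define G where "G = {i. i < n \<and> p i \<noteq> i}"
    define F where "F = {i. i < n \<and> p i = i}"
    have FG: "{..<n} = F \<union> G" "F \<inter> G = {}" "finite F" "finite G"
      by (auto simp: F_def G_def)
    define s :: "'g smax" where "s = (if evenperm p then 1 else smax_neg 1)"
    have s: "s \<noteq> 0" "smod s = 0" by (auto simp: s_def smax_ops)
    have s': "(if evenperm p then 1 else smax_poly_neg 1) = [:s:]"
      by (simp add: s_def smax_poly_neg_def one_pCons)
    define c where "c = s * (\<Prod>i\<in>G. smax_neg (A $$ (i, p i)))"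
    have "(\<Prod>i<n. (if i = p i then [:0, 1:] else 0) + [:smax_neg (A $$ (i, p i)):]) =
       (\<Prod>i\<in>F. (if i = p i then [:0, 1:] else 0) + [:smax_neg (A $$ (i, p i)):]) *
       (\<Prod>i\<in>G. (if i = p i then [:0, 1:] else 0) + [:smax_neg (A $$ (i, p i)):])"
      using FG by (simp add: prod.union_disjoint)
    also have "(\<Prod>i\<in>F. (if i = p i then [:0, 1:] else 0) + [:smax_neg (A $$ (i, p i)):]) = prod ?L F"
      by (intro prod.cong) (auto simp: F_def)
    also have "(\<Prod>i\<in>G. (if i = p i then [:0, 1:] else 0) + [:smax_neg (A $$ (i, p i)):])
        = (\<Prod>i\<in>G. [:smax_neg (A $$ (i, p i)):])"
      by (intro prod.cong) (auto simp: G_def)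
    finally have Tp: "T p = Polynomial.smult c (prod ?L F)"
      by (simp add: T_def s' prod_const_poly c_def mult.commute)
    have P: "?P = prod ?L F * prod ?L G"
      using FG by (simp add: prod.union_disjoint)
    have c: "smax_dom c (\<Prod>i\<in>G. smax_neg (A $$ (i, i)))"
      unfolding c_def G_def
      by (rule smax_dom_perm_prod[OF p ne, of "\<lambda>i j. A $$ (i, j)"]) (use d off s in auto)
    have G0: "coeff (prod ?L G) 0 = (\<Prod>i\<in>G. smax_neg (A $$ (i, i)))"
      by (simp add: poly_0_coeff_0[symmetric] poly_prod)
    show "?P + T p = ?P"
    proof (rule poly_eqI)
      fix k
      have "coeff ?P k = (\<Sum>j\<le>k. coeff (prod ?L F) j * coeff (prod ?L G) (k - j))"
        by (simp add: P coeff_mult)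
      \<comment> \<open>The summand \<open>j = k\<close> pairs coefficient \<open>k\<close> of
        \<open>prod ?L F\<close> with the constant coefficient of \<open>prod ?L G\<close>; it
        dominates coefficient \<open>k\<close> of \<open>T p\<close>, and the other summands cannot
        undo this.\<close>
      also have "\<dots> = coeff (prod ?L F) k * coeff (prod ?L G) 0 +
          (\<Sum>j\<in>{..k} - {k}. coeff (prod ?L F) j * coeff (prod ?L G) (k - j))"
        by (subst sum.remove[of _ k]) auto
      finally have "smax_dom (coeff (T p) k) (coeff ?P k)"
        using smax_dom_add[OF smax_dom_mult[OF c, of "coeff (prod ?L F) k"]]
        by (simp add: Tp G0 mult.commute)
      then show "coeff (?P + T p) k = coeff ?P k" by (simp add: smax_dom_absorb)
    qed
  qed
  finally show ?thesis .
qed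

text \<open>Evaluation respects sums and products, hence the permutation expansion; only the sign
  \<open>smax_poly_neg 1\<close> needs a computation of its own.\<close>

lemma smax_det_shift_eq_poly: "smax_det_shift \<gamma> A = poly (smax_char_poly A) \<gamma>"
proof -
  have "poly (smax_poly_neg 1) \<gamma> = smax_neg 1"
    by (simp add: smax_poly_neg_def one_pCons)
  then show ?thesis
    by (auto simp: smax_det_shift_def smax_char_poly_def sym_det_def poly_sum poly_prod smax_minus_def
      intro!: sum.cong prod.cong arg_cong2[of _ _ _ _ "(*)"])
qed

section \<open>Tropical positive definiteness\<close>

text \<open>Test vectors: a unit vector isolates a diagonal entry. A vector supported on
  \<open>i\<close> and \<open>j\<close>, scaled so that both diagonal terms equal the unit and
  signed so that both cross terms are negative, has a positive value only if the cross terms are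
  dominated. Divisibility provides the square roots of the diagonal entries used for
  scaling.\<close>

lemma smax_TPD_imp:
  fixes A :: "'g::linordered_ab_group_add smax mat"
  assumes div: "divisible_group TYPE('g)" and tpd: "smax_TPD n A"
  shows "A \<in> carrier_mat n n"
    and "i < n \<Longrightarrow> \<exists>g. A $$ (i, i) = SPos g"
    and "i < n \<Longrightarrow> j < n \<Longrightarrow> i \<noteq> j \<Longrightarrow> A $$ (i, j) \<noteq> 0 \<Longrightarrow>
        smod (A $$ (i, j)) + smod (A $$ (i, j)) < smod (A $$ (i, i)) + smod (A $$ (j, j))"
proof -
  show A: "A \<in> carrier_mat n n" using tpd by (simp add: smax_TPD_def)
  have sgn: "i < n \<Longrightarrow> j < n \<Longrightarrow> smax_signed (A $$ (i, j))" for i j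
    using tpd by (simp add: smax_TPD_def)
  have sym: "i < n \<Longrightarrow> j < n \<Longrightarrow> A $$ (i, j) = A $$ (j, i)" for i j
    using tpd A unfolding smax_TPD_def by (metis carrier_matD index_transpose_mat(1))
  have pd: "\<exists>g. (\<Sum>i<n. \<Sum>j<n. x i * A $$ (i, j) * x j) = SPos g"
    if "\<And>i. smax_signed (x i)" "\<exists>i<n. x i \<noteq> 0" for x
  proof -
    have "smax_less 0 (\<Sum>i<n. \<Sum>j<n. x i * A $$ (i, j) * x j)"
      using tpd that by (auto simp: smax_TPD_def)
    then show ?thesis
      by (cases "\<Sum>i<n. \<Sum>j<n. x i * A $$ (i, j) * x j")
        (auto simp: smax_less_def smax_minus_def smax_pos_or_zero_def smax_ops)
  qed
  show diag: "\<exists>g. A $$ (i, i) = SPos g" if i: "i < n" for i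
  proof -
    define x :: "nat \<Rightarrow> 'g smax" where "x = (\<lambda>k. if k = i then 1 else 0)"
    have "(\<Sum>k<n. \<Sum>j<n. x k * A $$ (k, j) * x j) = (\<Sum>k<n. if k = i then A $$ (i, i) else 0)"
      using i by (intro sum.cong refl) (auto simp: x_def if_distrib[of "\<lambda>t. _ * t"] cong: if_cong)
    also have "\<dots> = A $$ (i, i)" using i by simp
    finally have *: "(\<Sum>k<n. \<Sum>j<n. x k * A $$ (k, j) * x j) = A $$ (i, i)" .
    have "\<exists>g. (\<Sum>k<n. \<Sum>j<n. x k * A $$ (k, j) * x j) = SPos g"
      using i by (intro pd) (auto simp: x_def smax_signed_def smax_ops)
    then show ?thesis by (simp only: *)
  qed
  show "smod (A $$ (i, j)) + smod (A $$ (i, j)) < smod (A $$ (i, i)) + smod (A $$ (j, j))"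
    if ij: "i < n" "j < n" "i \<noteq> j" and nz: "A $$ (i, j) \<noteq> 0"
  proof -
    obtain a b where ab: "A $$ (i, i) = SPos a" "A $$ (j, j) = SPos b" using diag ij by blast
    have half: "\<exists>h. h + h = g" for g :: 'g
    proof -
      obtain h where "(\<Sum>k<2::nat. h) = g"
        using div unfolding divisible_group_def by (meson zero_less_numeral)
      then show ?thesis by (auto simp: numeral_2_eq_2)
    qed
    obtain a' b' where h: "a' + a' = a" "b' + b' = b" using half by meson
    obtain c where c: "A $$ (i, j) = SPos c \<or> A $$ (i, j) = SNeg c"
      using nz sgn[OF ij(1,2)] by (cases "A $$ (i, j)") (auto simp: smax_signed_def smax_ops)
    \<comment> \<open>The sign opposite to that of \<open>A $$ (i, j)\<close> makes the cross terms
      negative; the modulus \<open>- b'\<close> normalizes the diagonal term of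
      \<open>j\<close>.\<close>
    define xj where "xj = (if A $$ (i, j) = SPos c then SNeg (- b') else SPos (- b'))"
    define x :: "nat \<Rightarrow> 'g smax" where "x = (\<lambda>k. if k = i then SPos (- a') else if k = j then xj else 0)"
    have inner: "(\<Sum>l<n. x k * A $$ (k, l) * x l) = x k * A $$ (k, i) * x i + x k * A $$ (k, j) * x j" for k
    proof -
      have "(\<Sum>l<n. x k * A $$ (k, l) * x l) = (\<Sum>l\<in>{i, j}. x k * A $$ (k, l) * x l)"
        using ij by (intro sum.mono_neutral_right) (auto simp: x_def)
      then show ?thesis using ij by simp
    qed
    have "(\<Sum>k<n. \<Sum>l<n. x k * A $$ (k, l) * x l) =
        (\<Sum>k\<in>{i, j}. x k * A $$ (k, i) * x i + x k * A $$ (k, j) * x j)"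
      unfolding inner using ij by (intro sum.mono_neutral_right) (auto simp: x_def)
    also have "\<dots> = x i * A $$ (i, i) * x i + x i * A $$ (i, j) * x j +
        (x j * A $$ (i, j) * x i + x j * A $$ (j, j) * x j)"
      using ij sym[of j i] by simp
    finally have *: "(\<Sum>k<n. \<Sum>l<n. x k * A $$ (k, l) * x l) = \<dots>" .
    have "\<exists>g. (\<Sum>k<n. \<Sum>l<n. x k * A $$ (k, l) * x l) = SPos g"
      using ij by (intro pd) (auto simp: x_def xj_def smax_signed_def smax_ops)
    then obtain g where g: "x i * A $$ (i, i) * x i + x i * A $$ (i, j) * x j +
        (x j * A $$ (i, j) * x i + x j * A $$ (j, j) * x j) = SPos g"
      unfolding * by blast
    have e: "- a' + a + - a' = 0" "- b' + b + - b' = 0" using h by (auto simp: algebra_simps)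
    have t: "x i * A $$ (i, i) * x i = SPos 0" "x j * A $$ (j, j) * x j = SPos 0"
      using ij ab e by (auto simp: x_def xj_def smax_ops)
    have u: "x i * A $$ (i, j) * x j = SNeg (c - a' - b')" "x j * A $$ (i, j) * x i = SNeg (c - a' - b')"
      using ij c by (auto simp: x_def xj_def smax_ops algebra_simps)
    \<comment> \<open>Modulus \<open>0\<close> in the cross terms would make the sum balanced, and a
      larger one would make it negative.\<close>
    have "c - a' - b' < 0"
      using g unfolding t u by (auto simp: smax_ops split: if_splits)
    then have "c < a' + b'" by (simp add: algebra_simps)
    then have "c + c < (a' + b') + (a' + b')" by (intro add_strict_mono)
    also have "\<dots> = a + b" using h by (metis add.assoc add.commute)
    finally show ?thesis using c ab by auto
  qed
qed


section \<open>Multiplicities of tropical roots\<close>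

text \<open>A signed sum determines \<open>p\<close>, since balance between signed elements is
  equality; a balanced sum, arising from a tie of opposite signs, only bounds the modulus of
  \<open>p\<close> from above.\<close>

lemma smax_bal_add_signedD:
  fixes p x y :: "'g::linordered_ab_group_add smax"
  assumes "smax_signed p" "smax_signed x" "smax_signed y" "smax_bal p (x + y)"
  shows "p \<noteq> 0 \<Longrightarrow> (x \<noteq> 0 \<and> smod p \<le> smod x) \<or> (y \<noteq> 0 \<and> smod p \<le> smod y)"
    and "x \<noteq> 0 \<Longrightarrow> y \<noteq> 0 \<longrightarrow> smod y < smod x \<Longrightarrow> p \<noteq> 0 \<and> smod p = smod x"
    and "y \<noteq> 0 \<Longrightarrow> x \<noteq> 0 \<longrightarrow> smod x < smod y \<Longrightarrow> p \<noteq> 0 \<and> smod p = smod y"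
  using assms
  by (cases p; cases x; cases y;
      auto simp: smax_ops smax_bal_def smax_minus_def smax_balanced_def smax_signed_def split: if_splits)+

text \<open>For the weighted coefficients \<open>p\<^sub>k \<gamma>\<^sup>k\<close> of a polynomial this is the edge of slope \<open>\<gamma>\<close> of the
  Newton polygon.\<close>
definition max_range :: "(nat \<Rightarrow> 'g::linordered_ab_group_add smax) \<Rightarrow> nat \<Rightarrow> nat \<Rightarrow> 'g \<Rightarrow> bool" where
  "max_range p a b M \<longleftrightarrow> a \<le> b \<and> p a \<noteq> 0 \<and> p b \<noteq> 0 \<and> smod (p a) = M \<and> smod (p b) = M \<and>
     (\<forall>k. p k \<noteq> 0 \<longrightarrow> smod (p k) \<le> M \<and> (smod (p k) = M \<longrightarrow> a \<le> k \<and> k \<le> b))"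

lemma max_range_unique:
  assumes "max_range p a b M" "max_range p a' b' M'"
  shows "a = a' \<and> b = b'"
  using assms unfolding max_range_def by (metis order_antisym)

definition weighted :: "'g::linordered_ab_group_add smax \<Rightarrow> 'g smax poly \<Rightarrow> nat \<Rightarrow> 'g smax" where
  "weighted \<gamma> P k = coeff P k * \<gamma> ^ k"

lemma SPos_power_nonzero: "SPos g ^ k \<noteq> (0 :: 'g::linordered_ab_group_add smax)"
  by (induction k) (auto simp: smax_mult_eq_0_iff, auto simp: smax_ops)

lemma SPos_power: "\<exists>h. SPos g ^ k = (SPos h :: 'g::linordered_ab_group_add smax)"
  by (induction k) (auto simp: smax_ops)

lemma weighted_signed:
  "smax_poly_signed P \<Longrightarrow> smax_signed (weighted (SPos g) P k)"
  using SPos_power[of g k]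
  by (cases "coeff P k") (auto simp: weighted_def smax_poly_signed_def smax_signed_def smax_ops)

lemma smax_bal_mult_SPos: "smax_bal x y \<Longrightarrow> smax_bal (x * SPos h) (y * SPos h)"
  by (cases x; cases y)
    (auto simp: smax_bal_def smax_minus_def smax_balanced_def smax_ops split: if_splits)

lemma max_range_exists:
  assumes "P \<noteq> 0"
  shows "\<exists>a b M. max_range (weighted (SPos g) P) a b M"
proof -
  let ?w = "weighted (SPos g) P"
  define S where "S = {k. ?w k \<noteq> 0}"
  have "k \<in> S \<Longrightarrow> k \<le> degree P" for k
    using coeff_eq_0[of P k] by (cases "k \<le> degree P") (auto simp: S_def weighted_def)
  then have fin: "finite S" by (meson finite_nat_set_iff_bounded_le)
  have "degree P \<in> S"
    using assms SPos_power_nonzero[of g "degree P"] by (simp add: S_def weighted_def smax_mult_eq_0_iff)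
  then have ne: "S \<noteq> {}" by auto
  define M where "M = Max ((\<lambda>k. smod (?w k)) ` S)"
  define T where "T = {k \<in> S. smod (?w k) = M}"
  have "M \<in> (\<lambda>k. smod (?w k)) ` S" unfolding M_def using fin ne by (intro Max_in) auto
  then have T: "T \<noteq> {}" "finite T" using fin by (auto simp: T_def)
  have "smod (?w k) \<le> M" if "k \<in> S" for k unfolding M_def using fin that by auto
  moreover have "Min T \<in> T" "Max T \<in> T" "Min T \<le> Max T" using T by auto
  ultimately have "max_range ?w (Min T) (Max T) M"
    using T by (auto simp: max_range_def T_def S_def)
  then show ?thesis by blast
qed

section \<open>Effect of a tropical linear factor on the maximal range\<close>

context
  fixes g d :: "'g::linordered_ab_group_add" and P Q :: "'g smax poly"
  assumes P: "smax_poly_signed P" and Q: "smax_poly_signed Q"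
    and bal: "smax_poly_bal P ([:smax_neg (SPos d), 1:] * Q)"
begin

private abbreviation "p \<equiv> weighted (SPos g) P"
private abbreviation "q \<equiv> weighted (SPos g) Q"
text \<open>The two contributions to the weighted coefficient \<open>k\<close> of the product:
  \<open>x k\<close> comes from the constant term of the linear factor, \<open>y k\<close> from
  \<open>X\<close>, where the raised index costs one factor \<open>SPos g\<close>.\<close>

private abbreviation "x k \<equiv> SNeg d * q k"
private abbreviation "y k \<equiv> (if k = 0 then 0 else SPos g * q (k - 1))"

private lemma bal_weighted: "smax_bal (p k) (x k + y k)"
proof -
  obtain h where h: "SPos g ^ k = (SPos h :: 'g smax)" using SPos_power by blast
  have "smax_bal (coeff P k) (coeff ([:smax_neg (SPos d), 1:] * Q) k)"
    using bal by (simp add: smax_poly_bal_def)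
  then have "smax_bal (coeff P k * SPos h) (coeff ([:smax_neg (SPos d), 1:] * Q) k * SPos h)"
    by (rule smax_bal_mult_SPos)
  moreover have "coeff ([:smax_neg (SPos d), 1:] * Q) k * SPos g ^ k = x k + y k"
    by (cases k) (simp_all add: weighted_def algebra_simps)
  ultimately show ?thesis by (simp add: weighted_def h)
qed

private lemma sgn: "smax_signed (p k)" "smax_signed (x k)" "smax_signed (y k)"
  using weighted_signed[OF P, of g k] weighted_signed[OF Q, of g k] weighted_signed[OF Q, of g "k - 1"]
  by (cases "q k"; cases "q (k - 1)"; auto simp: smax_signed_def smax_ops)+

private lemmas step = smax_bal_add_signedD[OF sgn bal_weighted]

private lemma xy:
  "x k \<noteq> 0 \<longleftrightarrow> q k \<noteq> 0" "q k \<noteq> 0 \<Longrightarrow> smod (x k) = d + smod (q k)"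
  "y k \<noteq> 0 \<longleftrightarrow> k > 0 \<and> q (k - 1) \<noteq> 0" "k > 0 \<Longrightarrow> q (k - 1) \<noteq> 0 \<Longrightarrow> smod (y k) = g + smod (q (k - 1))"
  by (auto simp: smax_mult_eq_0_iff smod_mult, auto simp: smax_ops)
    (cases "q k"; cases "q (k-1)"; simp add: smax_ops)+

text \<open>When the constant term of the factor strictly wins at index \<open>k\<close>, no tie
  occurs and the modulus of \<open>p k\<close> is forced. \<open>step_high\<close> is the mirror
  case, where \<open>X\<close> wins.\<close>

private lemma step_low:
  assumes "q k \<noteq> 0" "k > 0 \<Longrightarrow> q (k - 1) \<noteq> 0 \<Longrightarrow> g + smod (q (k - 1)) < d + smod (q k)"
  shows "p k \<noteq> 0 \<and> smod (p k) = d + smod (q k)"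
proof -
  have "p k \<noteq> 0 \<and> smod (p k) = smod (x k)"
    using assms xy[of k] by (intro step(2)) auto
  then show ?thesis using xy(2)[OF assms(1)] by simp
qed

private lemma step_high:
  assumes "q k \<noteq> 0" "q (Suc k) \<noteq> 0 \<Longrightarrow> d + smod (q (Suc k)) < g + smod (q k)"
  shows "p (Suc k) \<noteq> 0 \<and> smod (p (Suc k)) = g + smod (q k)"
proof -
  have "p (Suc k) \<noteq> 0 \<and> smod (p (Suc k)) = smod (y (Suc k))"
    using assms xy[of "Suc k"] by (intro step(3)) auto
  then show ?thesis using xy(4)[of "Suc k"] assms(1) by simp
qed

text \<open>With equal slopes the contributions at \<open>k\<close> have moduli
  \<open>g + smod (q k)\<close> and \<open>g + smod (q (k - 1))\<close>. At \<open>a\<close> only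
  the first reaches \<open>g + M\<close>, at \<open>Suc b\<close> only the second, so both ends are
  free of ties; ties in between cannot push the modulus above \<open>g + M\<close>.\<close>

lemma max_range_step_eq:
  assumes d: "d = g" and m: "max_range q a b M"
  shows "max_range p a (Suc b) (g + M)"
proof -
  have M: "q k \<noteq> 0 \<Longrightarrow> smod (q k) \<le> M" "q k \<noteq> 0 \<Longrightarrow> smod (q k) = M \<Longrightarrow> a \<le> k \<and> k \<le> b"
    and ab: "a \<le> b" "q a \<noteq> 0" "q b \<noteq> 0" "smod (q a) = M" "smod (q b) = M" for k
    using m by (auto simp: max_range_def)
  have lt: "q k \<noteq> 0 \<Longrightarrow> \<not> (a \<le> k \<and> k \<le> b) \<Longrightarrow> smod (q k) < M" for k
    using M[of k] by (metis order.not_eq_order_implies_strict)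
  have A: "p a \<noteq> 0 \<and> smod (p a) = g + M"
    using step_low[of a] ab lt[of "a - 1"] d by simp
  have B: "p (Suc b) \<noteq> 0 \<and> smod (p (Suc b)) = g + M"
    using step_high[of b] ab lt[of "Suc b"] d by simp
  have C: "smod (p k) \<le> g + M \<and> (smod (p k) = g + M \<longrightarrow> a \<le> k \<and> k \<le> Suc b)" if "p k \<noteq> 0" for k
    using step(1)[OF that]
  proof
    assume *: "x k \<noteq> 0 \<and> smod (p k) \<le> smod (x k)"
    then have q: "q k \<noteq> 0" "smod (p k) \<le> g + smod (q k)" using xy(1,2)[of k] d by auto
    with M[of k] show ?thesis
      by (metis add_le_cancel_left le_SucI order.trans order_antisym)
  next
    assume *: "y k \<noteq> 0 \<and> smod (p k) \<le> smod (y k)"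
    then have q: "k > 0" "q (k - 1) \<noteq> 0" "smod (p k) \<le> g + smod (q (k - 1))"
      using xy(3,4)[of k] by auto
    have "smod (p k) = g + M \<Longrightarrow> smod (q (k - 1)) = M"
      using q M(1)[of "k - 1"] by (metis add_le_cancel_left order_antisym)
    moreover have "smod (p k) \<le> g + M"
      using q(3) M(1)[OF q(2)] by (meson add_left_mono order.trans)
    ultimately show ?thesis using M(2)[OF q(2)] q(1) by auto
  qed
  show ?thesis using A B C ab unfolding max_range_def by auto
qed

text \<open>For \<open>d < g\<close> every contribution of the constant term stays below
  \<open>g + M\<close>, so only the shift by \<open>X\<close> is visible.\<close>

lemma max_range_step_less:
  assumes d: "d < g" and m: "max_range q a b M"
  shows "max_range p (Suc a) (Suc b) (g + M)"
proof -
  have M: "q k \<noteq> 0 \<Longrightarrow> smod (q k) \<le> M" "q k \<noteq> 0 \<Longrightarrow> smod (q k) = M \<Longrightarrow> a \<le> k \<and> k \<le> b"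
    and ab: "a \<le> b" "q a \<noteq> 0" "q b \<noteq> 0" "smod (q a) = M" "smod (q b) = M" for k
    using m by (auto simp: max_range_def)
  have lt: "q k \<noteq> 0 \<Longrightarrow> d + smod (q k) < g + M" for k
    using M(1)[of k] d by (simp add: add_less_le_mono)
  have A: "p (Suc c) \<noteq> 0 \<and> smod (p (Suc c)) = g + M" if "q c \<noteq> 0" "smod (q c) = M" for c
    using step_high[of c] that lt[of "Suc c"] by simp
  have C: "smod (p k) \<le> g + M \<and> (smod (p k) = g + M \<longrightarrow> Suc a \<le> k \<and> k \<le> Suc b)" if "p k \<noteq> 0" for k
    using step(1)[OF that]
  proof
    assume *: "x k \<noteq> 0 \<and> smod (p k) \<le> smod (x k)"
    then have q: "q k \<noteq> 0" "smod (p k) \<le> d + smod (q k)" using xy(1,2)[of k] by auto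
    with lt[of k] show ?thesis by auto
  next
    assume *: "y k \<noteq> 0 \<and> smod (p k) \<le> smod (y k)"
    then have q: "k > 0" "q (k - 1) \<noteq> 0" "smod (p k) \<le> g + smod (q (k - 1))"
      using xy(3,4)[of k] by auto
    have "smod (p k) = g + M \<Longrightarrow> smod (q (k - 1)) = M"
      using q M(1)[of "k - 1"] by (metis add_le_cancel_left order_antisym)
    moreover have "smod (p k) \<le> g + M"
      using q(3) M(1)[OF q(2)] by (meson add_left_mono order.trans)
    ultimately show ?thesis using M(2)[OF q(2)] q(1) by auto
  qed
  show ?thesis using A[of a] A[of b] C ab unfolding max_range_def by auto
qed

text \<open>For \<open>g < d\<close> every contribution of \<open>X\<close> stays below
  \<open>d + M\<close>, so the indices of maximal modulus do not move.\<close>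

lemma max_range_step_greater:
  assumes d: "g < d" and m: "max_range q a b M"
  shows "max_range p a b (d + M)"
proof -
  have M: "q k \<noteq> 0 \<Longrightarrow> smod (q k) \<le> M" "q k \<noteq> 0 \<Longrightarrow> smod (q k) = M \<Longrightarrow> a \<le> k \<and> k \<le> b"
    and ab: "a \<le> b" "q a \<noteq> 0" "q b \<noteq> 0" "smod (q a) = M" "smod (q b) = M" for k
    using m by (auto simp: max_range_def)
  have lt: "q k \<noteq> 0 \<Longrightarrow> g + smod (q k) < d + M" for k
    using M(1)[of k] d by (simp add: add_less_le_mono)
  have A: "p c \<noteq> 0 \<and> smod (p c) = d + M" if "q c \<noteq> 0" "smod (q c) = M" for c
    using step_low[of c] that lt[of "c - 1"] by simp
  have C: "smod (p k) \<le> d + M \<and> (smod (p k) = d + M \<longrightarrow> a \<le> k \<and> k \<le> b)" if "p k \<noteq> 0" for k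
    using step(1)[OF that]
  proof
    assume *: "x k \<noteq> 0 \<and> smod (p k) \<le> smod (x k)"
    then have q: "q k \<noteq> 0" "smod (p k) \<le> d + smod (q k)" using xy(1,2)[of k] by auto
    with M[of k] show ?thesis
      by (metis add_le_cancel_left order.trans order_antisym)
  next
    assume *: "y k \<noteq> 0 \<and> smod (p k) \<le> smod (y k)"
    then have q: "q (k - 1) \<noteq> 0" "smod (p k) \<le> g + smod (q (k - 1))"
      using xy(3,4)[of k] by auto
    with lt[of "k - 1"] show ?thesis by auto
  qed
  show ?thesis using A[of a] A[of b] C ab unfolding max_range_def by auto
qed

end

text \<open>By \<open>max_range_step_eq\<close> and uniqueness of the range, any admissible quotient
  \<open>Q\<close> has a range shorter by exactly one, whichever \<open>Q\<close> is chosen.\<close>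

lemma smax_mult_ge_le_range:
  assumes "smax_mult_ge m P (SPos g)" "smax_poly_signed P" "max_range (weighted (SPos g) P) a b M"
  shows "m \<le> b - a"
  using assms
proof (induction m arbitrary: P a b M)
  case 0
  then show ?case by simp
next
  case (Suc m)
  from Suc.prems(1) obtain Q where Q: "smax_poly_signed Q"
    "smax_poly_bal P ([:smax_neg (SPos g), 1:] * Q)" "smax_mult_ge m Q (SPos g)" by auto
  \<comment> \<open>If \<open>Q\<close> were zero, the signed coefficients of \<open>P\<close> would
    balance zero and hence vanish, although the one at \<open>a\<close> does not.\<close>
  have "Q \<noteq> 0"
  proof
    assume "Q = 0"
    then have "smax_bal (coeff P a) 0" using Q(2) by (simp add: smax_poly_bal_def)
    then have "coeff P a = 0" using Suc.prems(2)
      using smax_bal_add_signedD(1)[of "coeff P a" 0 0]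
      by (auto simp: smax_poly_signed_def) (auto simp: smax_signed_def smax_ops)
    then show False using Suc.prems(3) by (simp add: max_range_def weighted_def)
  qed
  then obtain a' b' M' where m: "max_range (weighted (SPos g) Q) a' b' M'"
    using max_range_exists by blast
  have "max_range (weighted (SPos g) P) a' (Suc b') (g + M')"
    by (rule max_range_step_eq[OF Suc.prems(2) Q(1,2) refl m])
  then have "a = a'" "b = Suc b'" using max_range_unique[OF Suc.prems(3)] by auto
  moreover have "m \<le> b' - a'" by (rule Suc.IH[OF Q(3,1) m])
  moreover have "a' \<le> b'" using m by (simp add: max_range_def)
  ultimately show ?case by simp
qed

section \<open>Products of tropical linear factors with positive roots\<close>

abbreviation smax_root_prod :: "'g::linordered_ab_group_add smax multiset \<Rightarrow> 'g smax poly" where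
  "smax_root_prod D \<equiv> (\<Prod>x\<in>#D. [:smax_neg x, 1:])"

lemma SPos_add: "SPos a + SPos b = SPos (max a b)" and SNeg_add: "SNeg a + SNeg b = SNeg (max a b)"
  and SNeg_mult: "SNeg a * SPos b = SNeg (a + b)" "SNeg a * SNeg b = SPos (a + b)"
  by (auto simp: smax_ops)

text \<open>A new factor adds \<open>SNeg d\<close> times coefficient \<open>k\<close> to
  coefficient \<open>k - 1\<close>; by parity both have the same sign, so no balanced coefficient
  ever arises. This is what makes the product signed.\<close>

lemma smax_root_prod_alternates:
  assumes "\<forall>x\<in>#D. \<exists>g. x = SPos g"
  shows "coeff (smax_root_prod D) k = 0 \<or>
    (\<exists>g. coeff (smax_root_prod D) k = (if even (size D + k) then SPos g else SNeg g))"
  using assms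
proof (induction D arbitrary: k)
  case empty
  then show ?case by (cases k) (auto simp: smax_ops)
next
  case (add x D)
  obtain d where d: "x = SPos d" using add.prems by auto
  have IH: "coeff (smax_root_prod D) j = 0 \<or>
    (\<exists>g. coeff (smax_root_prod D) j = (if even (size D + j) then SPos g else SNeg g))" for j
    using add by auto
  have c: "coeff (smax_root_prod (add_mset x D)) k = SNeg d * coeff (smax_root_prod D) k +
      (if k = 0 then 0 else coeff (smax_root_prod D) (k - 1))"
    by (cases k) (auto simp: d)
  show ?case
  proof (cases k)
    case 0
    then show ?thesis unfolding c using IH[of 0] by (auto simp: smax_ops)
  next
    case (Suc j)
    have "\<And>u v. (u = 0 \<or> (\<exists>g. u = (if even (Suc (size D + j)) then SPos g else SNeg g))) \<Longrightarrow>
       (v = 0 \<or> (\<exists>g. v = (if even (size D + j) then SPos g else SNeg g))) \<Longrightarrow>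
       SNeg d * u + v = 0 \<or> (\<exists>g. SNeg d * u + v = (if even (size D + j) then SPos g else SNeg g))"
      by (cases "even (size D + j)") (auto simp: SPos_add SNeg_add SNeg_mult)
    from this[of "coeff (smax_root_prod D) (Suc j)" "coeff (smax_root_prod D) j"]
    show ?thesis unfolding c using IH[of "Suc j"] IH[of j] by (simp add: Suc)
  qed
qed

lemma smax_root_prod_signed:
  assumes "\<forall>x\<in>#D. \<exists>g. x = SPos g"
  shows "smax_poly_signed (smax_root_prod D)"
  unfolding smax_poly_signed_def smax_signed_def
  using smax_root_prod_alternates[OF assms]
  by (metis smax.distinct(5) smax.distinct(9) smax.distinct(11) zero_smax_def)

lemma smax_bal_refl: "smax_bal x x"
  by (cases x) (auto simp: smax_bal_def smax_minus_def smax_balanced_def smax_ops)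

lemma smax_root_prod_mult_ge:
  assumes "\<forall>x\<in>#D. \<exists>g. x = SPos g" "m \<le> count D \<gamma>"
  shows "smax_mult_ge m (smax_root_prod D) \<gamma>"
  using assms
proof (induction m arbitrary: D)
  case (Suc m)
  then obtain D' where D: "D = add_mset \<gamma> D'"
    by (metis Suc_le_eq count_eq_zero_iff less_nat_zero_code multi_member_split not_gr_zero)
  have "smax_poly_bal (smax_root_prod D) ([:smax_neg \<gamma>, 1:] * smax_root_prod D')"
    by (simp add: D smax_poly_bal_def smax_bal_refl)
  moreover have "smax_poly_signed (smax_root_prod D')"
    using Suc.prems by (intro smax_root_prod_signed) (auto simp: D)
  moreover have "smax_mult_ge m (smax_root_prod D') \<gamma>"
    using Suc.prems by (intro Suc.IH) (auto simp: D)
  ultimately show ?case by auto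
qed auto

text \<open>Only a factor with root \<open>SPos g\<close> widens the range, by one; any other factor
  shifts it or leaves it in place.\<close>

lemma smax_root_prod_max_range:
  assumes "\<forall>x\<in>#D. \<exists>g. x = SPos g"
  shows "\<exists>a M. max_range (weighted (SPos g) (smax_root_prod D)) a (a + count D (SPos g)) M"
  using assms
proof (induction D)
  case empty
  have "max_range (weighted (SPos g) 1) 0 0 0"
    unfolding max_range_def weighted_def by (auto simp: coeff_1 smax_ops)
  then show ?case by auto
next
  case (add x D)
  obtain d where d: "x = SPos d" using add.prems by auto
  obtain a M where m: "max_range (weighted (SPos g) (smax_root_prod D)) a (a + count D (SPos g)) M"
    using add by auto
  have s: "smax_poly_signed (smax_root_prod (add_mset x D))" "smax_poly_signed (smax_root_prod D)"
    using add.prems by (intro smax_root_prod_signed; simp)+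
  have b: "smax_poly_bal (smax_root_prod (add_mset x D)) ([:smax_neg (SPos d), 1:] * smax_root_prod D)"
    by (simp add: d smax_poly_bal_def smax_bal_refl)
  consider "d = g" | "d < g" | "g < d" by (meson linorder_neqE)
  then show ?case
  proof cases
    case 1
    then have "a + count (add_mset x D) (SPos g) = Suc (a + count D (SPos g))" by (simp add: d)
    then show ?thesis using max_range_step_eq[OF s b 1 m] by metis
  next
    case 2
    then have "Suc a + count (add_mset x D) (SPos g) = Suc (a + count D (SPos g))" by (simp add: d)
    then show ?thesis using max_range_step_less[OF s b 2 m] by metis
  next
    case 3
    then have "a + count (add_mset x D) (SPos g) = a + count D (SPos g)" by (simp add: d)
    then show ?thesis using max_range_step_greater[OF s b 3 m] by metis
  qed
qed

text \<open>Removing factors one at a time gives the lower bound, the width of the range the upper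
  one; together they also show that the maximum behind \<open>GREATEST\<close> is attained.\<close>

theorem smax_root_mult_root_prod:
  assumes "\<forall>x\<in>#D. \<exists>g. x = SPos g"
  shows "smax_root_mult (smax_root_prod D) (SPos g) = count D (SPos g)"
  unfolding smax_root_mult_def
proof (rule Greatest_equality)
  show "smax_mult_ge (count D (SPos g)) (smax_root_prod D) (SPos g)"
    using assms by (rule smax_root_prod_mult_ge) simp
  fix m assume "smax_mult_ge m (smax_root_prod D) (SPos g)"
  with smax_root_prod_max_range[OF assms, of g] smax_root_prod_signed[OF assms]
  show "m \<le> count D (SPos g)" using smax_mult_ge_le_range by fastforce
qed

text \<open>The count of each positive element is its root multiplicity, which depends on the
  polynomial alone.\<close>

lemma smax_root_prod_inject:
  assumes "\<forall>x\<in>#D. \<exists>g. x = SPos g" "\<forall>x\<in>#E. \<exists>g. x = SPos g"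
    and "smax_root_prod D = smax_root_prod E"
  shows "D = E"
proof (rule multiset_eqI)
  fix x
  show "count D x = count E x"
  proof (cases "\<exists>g. x = SPos g")
    case True
    then show ?thesis using smax_root_mult_root_prod assms by metis
  next
    case False
    then show ?thesis using assms(1,2) by (metis count_inI)
  qed
qed

lemma smax_balanced_mult:
  "smax_balanced (x * y) \<longleftrightarrow> smax_balanced x \<or> smax_balanced (y :: 'g::linordered_ab_group_add smax)"
  by (cases x; cases y) (auto simp: smax_balanced_def smax_ops)

text \<open>A product is balanced exactly when some factor is, and for signed
  \<open>\<gamma>\<close> the factor at \<open>SPos d\<close> is balanced only for
  \<open>\<gamma> = SPos d\<close>.\<close>

lemma poly_smax_root_prod_balanced:
  assumes "\<forall>x\<in>#D. \<exists>g. x = SPos g" "smax_signed \<gamma>"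
  shows "smax_balanced (poly (smax_root_prod D) \<gamma>) \<longleftrightarrow> \<gamma> \<in># D"
  using assms(1)
proof (induction D)
  case empty
  then show ?case by (simp add: smax_balanced_def smax_ops)
next
  case (add x D)
  then obtain d where d: "x = SPos d" by auto
  have "smax_balanced (SNeg d + \<gamma>) \<longleftrightarrow> \<gamma> = SPos d"
    using assms(2) by (cases \<gamma>) (auto simp: smax_balanced_def smax_signed_def smax_ops)
  moreover have "poly (smax_root_prod (add_mset x D)) \<gamma> = (SNeg d + \<gamma>) * poly (smax_root_prod D) \<gamma>"
    by (simp add: d algebra_simps)
  ultimately show ?case using add by (simp only: smax_balanced_mult) (auto simp: d)
qed

theorem smax_alg_eig_mult_TPD:
  fixes A :: "'g::linordered_ab_group_add smax mat"
  assumes "divisible_group TYPE('g)" "smax_TPD n A"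
  defines "D \<equiv> mset (map (\<lambda>i. A $$ (i, i)) [0..<n])"
  shows "\<forall>x\<in>#D. \<exists>g. x = SPos g" "smax_char_poly A = smax_root_prod D"
    "smax_alg_eig_mult A \<gamma> = count D \<gamma>"
proof -
  note T = smax_TPD_imp[OF assms(1,2)]
  show D: "\<forall>x\<in>#D. \<exists>g. x = SPos g" using T(2) by (auto simp: D_def)
  have "smax_char_poly A = (\<Prod>i<n. [:smax_neg (A $$ (i, i)), 1:])"
    using T(2) by (intro smax_char_poly_eq_prod T(1,3)) (fastforce simp: smax_ops)+
  also have "\<dots> = smax_root_prod D"
    by (simp add: D_def prod_unfold_prod_mset multiset.map_comp comp_def atLeast0LessThan[symmetric])
  finally show P: "smax_char_poly A = smax_root_prod D" .
  have bal: "smax_bal x 0 \<longleftrightarrow> smax_balanced x" for x :: "'g smax"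
    by (cases x) (auto simp: smax_bal_def smax_minus_def smax_balanced_def smax_ops)
  show "smax_alg_eig_mult A \<gamma> = count D \<gamma>"
  proof (cases "\<gamma> \<in># D")
    case True
    then obtain g where g: "\<gamma> = SPos g" using D by blast
    then have "smax_signed \<gamma>" by (simp add: smax_signed_def)
    then show ?thesis using True poly_smax_root_prod_balanced[OF D, of \<gamma>]
      by (simp add: smax_alg_eig_mult_def smax_det_shift_eq_poly P bal g smax_root_mult_root_prod[OF D])
  next
    case False
    then show ?thesis using poly_smax_root_prod_balanced[OF D, of \<gamma>]
      by (auto simp: smax_alg_eig_mult_def smax_det_shift_eq_poly P bal count_eq_zero_iff)
  qed
qed

section \<open>Splitting of characteristic polynomials over a real closed field\<close>

lemma range_to_ac_add: "x \<in> range to_ac \<Longrightarrow> y \<in> range to_ac \<Longrightarrow> x + y \<in> range to_ac"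
  by (auto simp flip: to_ac_add)

lemma range_to_ac_uminus: "x \<in> range to_ac \<Longrightarrow> - x \<in> range to_ac"
  by (auto simp flip: to_ac_minus)

lemma range_to_ac_diff: "x \<in> range to_ac \<Longrightarrow> y \<in> range to_ac \<Longrightarrow> x - y \<in> range to_ac"
  by (auto simp flip: to_ac_diff)

lemma range_to_ac_mult: "x \<in> range to_ac \<Longrightarrow> y \<in> range to_ac \<Longrightarrow> x * y \<in> range to_ac"
  by (auto simp flip: to_ac_mult)

lemma range_to_ac_divide: "x \<in> range to_ac \<Longrightarrow> y \<in> range to_ac \<Longrightarrow> x / y \<in> range to_ac"
  by (auto simp flip: to_ac_divide)

lemma range_to_ac_of_nat: "of_nat k \<in> range to_ac"
  by (metis rangeI to_ac_of_nat)

lemma range_to_ac_power: "x \<in> range to_ac \<Longrightarrow> x ^ k \<in> range to_ac"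
  by (auto simp flip: to_ac_power)

lemma range_to_ac_0: "0 \<in> range to_ac"
  by (metis rangeI to_ac_0)

lemma range_to_ac_sum: "(\<And>i. i \<in> S \<Longrightarrow> f i \<in> range to_ac) \<Longrightarrow> sum f S \<in> range to_ac"
  by (induction S rule: infinite_finite_induct) (auto intro: range_to_ac_add range_to_ac_0)

lemmas range_to_ac_intros = range_to_ac_add range_to_ac_uminus range_to_ac_diff range_to_ac_mult
  range_to_ac_divide range_to_ac_of_nat range_to_ac_power range_to_ac_0 range_to_ac_sum

text \<open>Newton's identities in generating function form.\<close>
lemma fps_deriv_prod_linear:
  fixes M :: "'b::field multiset"
  defines "E \<equiv> (\<Prod>\<mu>\<in>#M. 1 - fps_const \<mu> * fps_X)"
  shows "fps_deriv E = - (E * Abs_fps (\<lambda>m. \<Sum>\<mu>\<in>#M. \<mu> ^ Suc m))"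
  unfolding E_def
proof (induction M)
  case empty
  have "Abs_fps (\<lambda>m. 0) = (0 :: 'b fps)" by (simp add: fps_eq_iff)
  then show ?case by simp
next
  case (add \<mu> M)
  let ?E = "\<Prod>\<mu>\<in>#M. 1 - fps_const \<mu> * fps_X" and ?S = "Abs_fps (\<lambda>m. \<Sum>\<mu>\<in>#M. \<mu> ^ Suc m)"
  let ?G = "Abs_fps (\<lambda>m. \<mu> ^ Suc m)"
  \<comment> \<open>\<open>?G\<close> is the geometric series of \<mu> / (1 - \<mu> X).\<close>
  have G: "(1 - fps_const \<mu> * fps_X) * ?G = fps_const \<mu>"
  proof (rule fps_ext)
    fix k show "((1 - fps_const \<mu> * fps_X) * ?G) $ k = fps_const \<mu> $ k"
      by (cases k) (simp_all add: ring_distribs mult.assoc)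
  qed
  have S: "Abs_fps (\<lambda>m. \<Sum>\<mu>\<in>#add_mset \<mu> M. \<mu> ^ Suc m) = ?G + ?S"
    by (simp add: fps_eq_iff)
  have "fps_deriv (\<Prod>\<mu>\<in>#add_mset \<mu> M. 1 - fps_const \<mu> * fps_X) =
      (1 - fps_const \<mu> * fps_X) * (- (?E * ?S)) - fps_const \<mu> * ?E"
    by (simp add: add.IH fps_const_neg[symmetric] del: fps_const_neg)
  also have "\<dots> = (1 - fps_const \<mu> * fps_X) * (- (?E * ?S)) - (1 - fps_const \<mu> * fps_X) * ?G * ?E"
    by (simp only: G)
  also have "\<dots> = - ((1 - fps_const \<mu> * fps_X) * ?E * (?G + ?S))"
    by (simp add: algebra_simps)
  finally show ?case by (simp only: S) simp
qed

lemma root_prod_degree_monic: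
  "degree (\<Prod>x\<in>#M. [:- x, 1 :: 'b::field:]) = size M" "lead_coeff (\<Prod>x\<in>#M. [:- x, 1 :: 'b:]) = 1"
proof -
  have "lead_coeff (\<Prod>x\<in>#M. [:- x, 1 :: 'b:]) = 1 \<and> degree (\<Prod>x\<in>#M. [:- x, 1 :: 'b:]) = size M"
  proof (induction M)
    case (add x M)
    then have "(\<Prod>x\<in>#M. [:- x, 1 :: 'b:]) \<noteq> 0" by auto
    then have "degree ([:- x, 1:] * (\<Prod>x\<in>#M. [:- x, 1 :: 'b:])) = Suc (size M)"
      using add by (subst degree_mult_eq) auto
    moreover have "lead_coeff ([:- x, 1:] * (\<Prod>x\<in>#M. [:- x, 1 :: 'b:])) = 1"
      using add by (subst lead_coeff_mult) auto
    ultimately show ?case by (simp del: mult_pCons_left)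
  qed simp
  then show "degree (\<Prod>x\<in>#M. [:- x, 1 :: 'b::field:]) = size M" "lead_coeff (\<Prod>x\<in>#M. [:- x, 1 :: 'b:]) = 1"
    by auto
qed

section \<open>Coefficients and power sums lying in the base field\<close>

context
  fixes M :: "'a::linordered_field alg_closure multiset"
begin

text \<open>\<open>E\<close> is the reversal of the polynomial with root multiset \<open>M\<close>,
  as \<open>E_eq\<close> shows. The exponent of \<open>s m\<close> is shifted by one to match the
  logarithmic derivative.\<close>

private definition "E = (\<Prod>\<mu>\<in>#M. 1 - fps_const \<mu> * fps_X)"
private definition "s m = (\<Sum>\<mu>\<in>#M. \<mu> ^ Suc m)"

private lemma E_rec: "of_nat (Suc k) * E $ Suc k = - (\<Sum>i\<le>k. E $ i * s (k - i))"
proof -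
  have "fps_deriv E $ k = - (E * Abs_fps s) $ k"
    unfolding E_def s_def fps_deriv_prod_linear by simp
  then show ?thesis by (simp add: fps_mult_nth atMost_atLeast0)
qed

private lemma E_0: "E $ 0 = 1"
  unfolding E_def by (induction M) auto

private lemma E_eq: "E $ k = (if k > size M then 0 else coeff (\<Prod>x\<in>#M. [:- x, 1:]) (size M - k))"
proof -
  have "E = fps_of_poly (reflect_poly (\<Prod>x\<in>#M. [:- x, 1:]))"
    unfolding E_def
  proof (induction M)
    case (add x M)
    have "reflect_poly [:- x, 1:] = [:1, - x:]"
      by (cases "x = 0") (simp_all add: reflect_poly_def)
    with add show ?case
      by (simp del: mult_pCons_left add: reflect_poly_mult fps_of_poly_mult fps_of_poly_linear')
  qed simp
  then show ?thesis by (simp add: coeff_reflect_poly root_prod_degree_monic)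
qed

private lemma E_range_iff:
  "(\<forall>k. E $ k \<in> range to_ac) \<longleftrightarrow> (\<forall>k. coeff (\<Prod>x\<in>#M. [:- x, 1:]) k \<in> range to_ac)"
proof safe
  fix k assume *: "\<forall>k. E $ k \<in> range to_ac"
  show "coeff (\<Prod>x\<in>#M. [:- x, 1:]) k \<in> range to_ac"
  proof (cases "k \<le> size M")
    case True
    then have "E $ (size M - k) = coeff (\<Prod>x\<in>#M. [:- x, 1:]) k" by (auto simp: E_eq)
    then show ?thesis using * by metis
  next
    case False
    then show ?thesis by (simp add: coeff_eq_0 root_prod_degree_monic range_to_ac_0)
  qed
qed (auto simp: E_eq range_to_ac_0)

text \<open>In Newton's recursion the highest power sum has coefficient \<open>E $ 0 = 1\<close>, so
  it is expressed through coefficients and lower power sums. Exponent zero just counts the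
  roots.\<close>

lemma power_sums_in_range:
  assumes "\<forall>k. coeff (\<Prod>x\<in>#M. [:- x, 1:]) k \<in> range to_ac"
  shows "(\<Sum>\<mu>\<in>#M. \<mu> ^ m) \<in> range to_ac"
proof (cases m)
  case 0
  then show ?thesis by (simp add: range_to_ac_of_nat)
next
  case (Suc k)
  have E: "E $ k \<in> range to_ac" for k using assms E_range_iff by blast
  have "s k \<in> range to_ac" for k
  proof (induction k rule: less_induct)
    case (less k)
    have "{..k} = insert 0 {1..k}" by auto
    then have "of_nat (Suc k) * E $ Suc k = - (s k + (\<Sum>i\<in>{1..k}. E $ i * s (k - i)))"
      by (simp add: E_rec E_0 del: of_nat_Suc)
    then have "s k = - (of_nat (Suc k) * E $ Suc k) - (\<Sum>i\<in>{1..k}. E $ i * s (k - i))"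
      by (simp del: of_nat_Suc)
    also have "\<dots> \<in> range to_ac"
      by (intro range_to_ac_intros E less.IH) auto
    finally show ?case .
  qed
  then show ?thesis by (simp add: Suc s_def)
qed

text \<open>The same recursion solved for the highest coefficient; the division by
  \<open>of_nat (Suc j)\<close> is legitimate in characteristic zero.\<close>

lemma coeffs_in_range:
  assumes "\<forall>m. (\<Sum>\<mu>\<in>#M. \<mu> ^ m) \<in> range to_ac"
  shows "coeff (\<Prod>x\<in>#M. [:- x, 1:]) k \<in> range to_ac"
proof -
  have s: "s k \<in> range to_ac" for k using assms unfolding s_def by blast
  have "E $ k \<in> range to_ac" for k
  proof (induction k rule: less_induct)
    case (less k)
    show ?case
    proof (cases k)
      case 0
      then show ?thesis using range_to_ac_of_nat[of 1] by (simp add: E_0)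
    next
      case (Suc j)
      have "E $ k = - (\<Sum>i\<le>j. E $ i * s (j - i)) / of_nat (Suc j)"
        unfolding Suc E_rec[symmetric] by (simp del: of_nat_Suc)
      also have "\<dots> \<in> range to_ac"
        by (intro range_to_ac_intros less.IH s) (auto simp: Suc)
      finally show ?thesis .
    qed
  qed
  then show ?thesis using E_range_iff by blast
qed

end

section \<open>Adjoining a square root of minus one to the base field\<close>

definition ac_i :: "'a::field alg_closure" where
  "ac_i = (SOME z. z ^ 2 = - 1)"

lemma ac_i_square: "ac_i * ac_i = - 1"
proof -
  have "ac_i ^ 2 = - 1"
    unfolding ac_i_def by (rule someI_ex) (rule nth_root_exists, simp)
  then show ?thesis by (simp add: power2_eq_square)
qed

definition gauss :: "'a::field alg_closure set" where
  "gauss = {to_ac a + to_ac b * ac_i | a b. True}"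

lemma gaussI: "to_ac a + to_ac b * ac_i \<in> gauss"
  by (auto simp: gauss_def)

lemma gaussE:
  assumes "z \<in> gauss"
  obtains a b where "z = to_ac a + to_ac b * ac_i"
  using assms by (auto simp: gauss_def)

lemma range_to_ac_subset_gauss: "range to_ac \<subseteq> gauss"
  using gaussI[of _ 0] by fastforce

lemma gauss_add: "z \<in> gauss \<Longrightarrow> w \<in> gauss \<Longrightarrow> z + w \<in> gauss"
proof (elim gaussE)
  fix a b c d assume "z = to_ac a + to_ac b * ac_i" "w = to_ac c + to_ac d * ac_i"
  then have "z + w = to_ac (a + c) + to_ac (b + d) * ac_i" by (simp add: algebra_simps)
  then show ?thesis using gaussI by metis
qed

lemma gauss_uminus: "z \<in> gauss \<Longrightarrow> - z \<in> gauss"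
proof (elim gaussE)
  fix a b assume "z = to_ac a + to_ac b * ac_i"
  then have "- z = to_ac (- a) + to_ac (- b) * ac_i" by (simp add: algebra_simps)
  then show ?thesis using gaussI by metis
qed

lemma gauss_diff: "z \<in> gauss \<Longrightarrow> w \<in> gauss \<Longrightarrow> z - w \<in> gauss"
  using gauss_add[of z "- w"] gauss_uminus by auto

lemma gauss_mult: "z \<in> gauss \<Longrightarrow> w \<in> gauss \<Longrightarrow> z * w \<in> gauss"
proof (elim gaussE)
  fix a b c d assume zw: "z = to_ac a + to_ac b * ac_i" "w = to_ac c + to_ac d * ac_i"
  have "z * w = to_ac (a * c) + to_ac (b * d) * (ac_i * ac_i) + to_ac (a * d + b * c) * ac_i"
    by (simp add: zw algebra_simps)
  also have "\<dots> = to_ac (a * c - b * d) + to_ac (a * d + b * c) * ac_i"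
    by (simp add: ac_i_square)
  finally show ?thesis using gaussI by metis
qed

lemma gauss_mult_of_nat: "z \<in> gauss \<Longrightarrow> of_nat k * z \<in> gauss"
  using range_to_ac_subset_gauss range_to_ac_of_nat by (blast intro: gauss_mult)

lemma gauss_divide: "z \<in> gauss \<Longrightarrow> w \<in> range to_ac \<Longrightarrow> z / w \<in> gauss"
proof -
  assume z: "z \<in> gauss" and "w \<in> range to_ac"
  then obtain x where "inverse w = to_ac x" by (auto simp flip: to_ac_inverse)
  then show ?thesis
    using gauss_mult[OF z, of "to_ac x"] range_to_ac_subset_gauss by (auto simp: divide_inverse)
qed

text \<open>The classical formula: with \<open>r\<close> the absolute value of \<open>z\<close>, the
  real and imaginary parts of a root have squares \<open>(r + a) / 2\<close> and
  \<open>(r - a) / 2\<close>, both nonnegative. The sign of the imaginary part is then adjusted to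
  yield \<open>b\<close>.\<close>

lemma gauss_sqrt:
  fixes z :: "'a::linordered_field alg_closure"
  assumes rcf: "real_closed_field TYPE('a)" and z: "z \<in> gauss"
  shows "\<exists>w\<in>gauss. w * w = z"
proof -
  obtain a b where ab: "z = to_ac a + to_ac b * ac_i" using z by (rule gaussE)
  have sq: "\<exists>y\<ge>0. y * y = x" if x: "0 \<le> x" for x :: 'a
  proof -
    obtain y where "y * y = x" using rcf x by (auto simp: real_closed_field_def)
    then show ?thesis by (intro exI[of _ "\<bar>y\<bar>"]) (auto simp: abs_mult_self_eq)
  qed
  obtain r where r: "r \<ge> 0" "r * r = a * a + b * b" using sq[of "a * a + b * b"] by auto
  have "\<bar>a\<bar> \<le> r"
  proof (rule ccontr)
    assume "\<not> \<bar>a\<bar> \<le> r"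
    then have "r * r < \<bar>a\<bar> * \<bar>a\<bar>" using r(1) by (intro mult_strict_mono') auto
    then show False using r(2) by simp
  qed
  then have "0 \<le> (r + a) / 2" "0 \<le> (r - a) / 2" by auto
  then obtain u t where u: "u \<ge> 0" "u * u = (r + a) / 2" and t: "t \<ge> 0" "t * t = (r - a) / 2"
    using sq by meson
  have "(2 * u * t) * (2 * u * t) = 4 * (u * u) * (t * t)" by (simp add: algebra_simps)
  also have "\<dots> = r * r - a * a" unfolding u t by (simp add: field_simps)
  also have "\<dots> = b * b" using r by simp
  finally have "2 * u * t = b \<or> 2 * u * t = - b" by (simp only: square_eq_iff)
  then obtain t' where t': "t' * t' = (r - a) / 2" "2 * u * t' = b"
    using t by (metis minus_mult_minus mult_minus_right minus_minus)
  let ?w = "to_ac u + to_ac t' * ac_i"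
  have "?w * ?w = to_ac (u * u) + to_ac (t' * t') * (ac_i * ac_i) + to_ac (2 * u * t') * ac_i"
    by (simp add: algebra_simps)
  also have "\<dots> = to_ac (u * u - t' * t') + to_ac b * ac_i"
    by (simp add: ac_i_square t'(2) del: to_ac_mult)
  also have "u * u - t' * t' = a" unfolding u t' by (simp add: field_simps)
  finally show ?thesis using ab gaussI by metis
qed

text \<open>The discriminant is the square of \<open>x - y\<close>, so \<open>gauss_sqrt\<close>
  puts \<open>x - y\<close> into \<open>gauss\<close>; \<open>x\<close> is half of
  \<open>(x + y) + (x - y)\<close>.\<close>

lemma gauss_quadratic:
  fixes x y :: "'a::linordered_field alg_closure"
  assumes rcf: "real_closed_field TYPE('a)" and "x + y \<in> gauss" "x * y \<in> gauss"
  shows "x \<in> gauss"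
proof -
  have "(x + y) * (x + y) - of_nat 4 * (x * y) \<in> gauss"
    by (intro gauss_diff gauss_mult_of_nat gauss_mult[OF assms(2,2)] assms(3))
  then obtain w where w: "w \<in> gauss" "w * w = (x + y) * (x + y) - of_nat 4 * (x * y)"
    using gauss_sqrt[OF rcf] by blast
  have "w * w = (x - y) * (x - y)" unfolding w by (simp add: algebra_simps)
  then have "x - y = w \<or> x - y = - w" by (simp only: square_eq_iff) auto
  then have "x - y \<in> gauss" using w gauss_uminus by auto
  then have "(x + y) + (x - y) \<in> gauss" using assms(2) by (rule gauss_add[rotated])
  then have "((x + y) + (x - y)) / of_nat 2 \<in> gauss"
    by (intro gauss_divide range_to_ac_of_nat)
  then show ?thesis by simp
qed

section \<open>Roots in the quadratic extension by Laplace's argument\<close>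

lemma poly_in_range_to_ac:
  assumes "\<And>k. coeff p k \<in> range to_ac"
  shows "\<exists>q. p = map_poly to_ac q \<and> degree q = degree p"
proof -
  have "map_poly to_ac (map_poly of_ac p) = p"
    using assms by (intro poly_eqI) (simp add: coeff_map_poly to_ac_of_ac)
  moreover have "degree (map_poly to_ac q) = degree q" for q :: "'a poly"
    by (rule degree_map_poly) simp
  ultimately show ?thesis by metis
qed

text \<open>This reduces power sums over pairs to power sums over single indices, and with the
  constant \<open>1\<close> it counts the pairs.\<close>

lemma square_sum_eq_sum_pairs:
  fixes f :: "nat \<Rightarrow> 'b::comm_ring_1"
  shows "(\<Sum>i<n. f i) ^ 2 = (\<Sum>i<n. f i ^ 2) + 2 * (\<Sum>(i, j)\<in>{(i, j). i < j \<and> j < n}. f i * f j)"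
proof (induction n)
  case 0
  then show ?case by simp
next
  case (Suc n)
  have eq: "{(i, j). i < j \<and> j < Suc n} = {(i, j). i < j \<and> j < n} \<union> (\<lambda>i. (i, n)) ` {..<n}"
    by (auto simp: less_Suc_eq)
  have fin: "finite {(i, j). i < j \<and> j < n}"
    by (rule finite_subset[of _ "{..<n} \<times> {..<n}"]) auto
  have "(\<Sum>(i, j)\<in>{(i, j). i < j \<and> j < Suc n}. f i * f j) =
      (\<Sum>(i, j)\<in>{(i, j). i < j \<and> j < n}. f i * f j) + (\<Sum>i<n. f i * f n)"
    unfolding eq by (subst sum.union_disjoint) (auto simp: fin sum.reindex inj_on_def)
  also have "(\<Sum>i<n. f i * f n) = (\<Sum>i<n. f i) * f n" by (simp add: sum_distrib_right)
  finally have step: "(\<Sum>(i, j)\<in>{(i, j). i < j \<and> j < Suc n}. f i * f j) =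
      (\<Sum>(i, j)\<in>{(i, j). i < j \<and> j < n}. f i * f j) + (\<Sum>i<n. f i) * f n" .
  have "(\<Sum>i<Suc n. f i) ^ 2 = (\<Sum>i<n. f i) ^ 2 + 2 * ((\<Sum>i<n. f i) * f n) + f n ^ 2"
    by (simp add: power2_sum)
  then show ?case unfolding step Suc by (simp add: algebra_simps)
qed

lemma card_pairs: "2 * card {(i, j). i < j \<and> j < n} = n * (n - 1)"
proof -
  have "(int n)^2 = int n + 2 * int (card {(i, j). i < j \<and> j < n})"
    using square_sum_eq_sum_pairs[of "\<lambda>_. 1 :: int" n] by (simp add: case_prod_beta)
  then have "int (2 * card {(i, j). i < j \<and> j < n}) = int n * (int n - 1)"
    by (simp add: power2_eq_square algebra_simps)
  also have "\<dots> = int (n * (n - 1))" by (cases n) (auto simp: algebra_simps)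
  finally show ?thesis by (simp only: of_nat_eq_iff)
qed

text \<open>Laplace's argument: for a polynomial of degree \<open>n\<close> with roots \<open>x\<^sub>i\<close>, the polynomial with
  roots \<open>(x\<^sub>i + c)(x\<^sub>j + c)\<close>, \<open>i < j\<close>, has degree \<open>n(n - 1)/2\<close>, which is divisible by a smaller
  power of \<open>2\<close>. Two values of \<open>c\<close> for which the induction hypothesis yields the same pair \<open>(i, j)\<close>
  give \<open>x\<^sub>i + x\<^sub>j\<close> and \<open>x\<^sub>i x\<^sub>j\<close>.\<close>
lemma exists_gauss_root_aux:
  fixes p :: "'a::linordered_field poly"
  assumes rcf: "real_closed_field TYPE('a)" and "degree p = 2 ^ k * m" "odd m"
  shows "\<exists>z\<in>gauss. poly (map_poly to_ac p) z = 0"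
  using assms(2,3)
proof (induction k arbitrary: p m)
  case 0
  then obtain x where "poly p x = 0" using rcf by (auto simp: real_closed_field_def)
  moreover have "poly (map_poly to_ac p) (to_ac x) = to_ac (poly p x)"
    by (induction p) (auto simp: map_poly_pCons)
  ultimately show ?case using range_to_ac_subset_gauss by (metis rangeI subsetD to_ac_0)
next
  case (Suc k)
  define n where "n = degree p"
  define P where "P = map_poly to_ac p"
  have "n > 0" using Suc.prems by (auto simp: n_def intro!: Nat.gr0I)
  have degP: "degree P = n" unfolding P_def n_def by (rule degree_map_poly) simp
  then have "P \<noteq> 0" using \<open>n > 0\<close> by auto
  then obtain M where M: "size M = n" "P = smult (lead_coeff P) (\<Prod>x\<in>#M. [:- x, 1:])"
    using alg_closed_imp_factorization degP by metis
  obtain xs where xs: "mset xs = M" using ex_mset by blast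
  have len: "length xs = n" using xs M by auto
  have Mrange: "coeff (\<Prod>x\<in>#M. [:- x, 1:]) k \<in> range to_ac" for k
  proof -
    have "coeff P k = lead_coeff P * coeff (\<Prod>x\<in>#M. [:- x, 1:]) k" by (subst M(2)) simp
    then have "coeff (\<Prod>x\<in>#M. [:- x, 1:]) k = coeff P k / lead_coeff P"
      using \<open>P \<noteq> 0\<close> by simp
    also have "\<dots> \<in> range to_ac"
      by (intro range_to_ac_divide) (auto simp: P_def coeff_map_poly)
    finally show ?thesis .
  qed
  have msum: "(\<Sum>\<mu>\<in>#M. f \<mu>) = (\<Sum>i<n. f (xs ! i))" for f :: "'a alg_closure \<Rightarrow> 'a alg_closure"
    unfolding xs[symmetric] len[symmetric]
    by (simp add: sum_mset_sum_list sum_list_sum_nth atLeast0LessThan flip: mset_map)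
  have pow: "(\<Sum>i<n. (xs ! i) ^ m) \<in> range to_ac" for m
  proof -
    have "(\<Sum>\<mu>\<in>#M. \<mu> ^ m) \<in> range to_ac" by (rule power_sums_in_range) (use Mrange in blast)
    then show ?thesis by (simp only: msum)
  qed
  \<comment> \<open>Binomial expansion reduces power sums of the shifted roots to those of the
    roots.\<close>
  have shift: "(\<Sum>i<n. (xs ! i + of_nat c) ^ m) \<in> range to_ac" for c m :: nat
  proof -
    have "(\<Sum>i<n. (xs ! i + of_nat c) ^ m) =
        (\<Sum>l\<le>m. of_nat (m choose l) * (\<Sum>i<n. (xs ! i) ^ l) * of_nat c ^ (m - l))"
      unfolding binomial_ring by (subst sum.swap) (simp only: sum_distrib_left sum_distrib_right)
    also have "\<dots> \<in> range to_ac" by (intro range_to_ac_intros pow)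
    finally show ?thesis .
  qed
  define I where "I = {(i, j). i < j \<and> j < n}"
  have finI: "finite I" unfolding I_def by (rule finite_subset[of _ "{..<n} \<times> {..<n}"]) auto
  \<comment> \<open>Halving \<open>n * (n - 1)\<close> removes one factor 2 from the even
    \<open>n\<close>, while \<open>n - 1\<close> is odd; this lowers \<open>k\<close> for the
    induction.\<close>
  have card: "card I = 2 ^ k * (m * (n - 1))"
    using card_pairs[of n] Suc.prems(1) unfolding I_def[symmetric] by (simp add: n_def)
  have oddn: "odd (m * (n - 1))"
    using Suc.prems \<open>n > 0\<close> by (auto simp: n_def)
  define g where "g = (\<lambda>c ij. (xs ! fst ij + of_nat c) * (xs ! snd ij + of_nat c) :: 'a alg_closure)"
  have "\<exists>ij\<in>I. g c ij \<in> gauss" for c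
  proof -
    define N where "N = image_mset (g c) (mset_set I)"
    have "(\<Sum>\<mu>\<in>#N. \<mu> ^ l) \<in> range to_ac" for l
    proof -
      have "(\<Sum>\<mu>\<in>#N. \<mu> ^ l) = (\<Sum>(i, j)\<in>I. (xs ! i + of_nat c) ^ l * (xs ! j + of_nat c) ^ l)"
        unfolding N_def by (simp add: g_def sum_unfold_sum_mset multiset.map_comp comp_def
            case_prod_beta power_mult_distrib)
      also have "\<dots> = ((\<Sum>i<n. (xs ! i + of_nat c) ^ l) ^ 2 - (\<Sum>i<n. (xs ! i + of_nat c) ^ (l * 2))) / of_nat 2"
        using square_sum_eq_sum_pairs[of "\<lambda>i. (xs ! i + of_nat c) ^ l" n] by (simp add: I_def power_mult)
      also have "\<dots> \<in> range to_ac" by (intro range_to_ac_intros shift)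
      finally show ?thesis .
    qed
    then have "coeff (\<Prod>x\<in>#N. [:- x, 1:]) l \<in> range to_ac" for l by (intro coeffs_in_range) auto
    then obtain q where q: "(\<Prod>x\<in>#N. [:- x, 1:]) = map_poly to_ac q"
      "degree q = degree (\<Prod>x\<in>#N. [:- x, 1:])"
      using poly_in_range_to_ac by blast
    have "degree q = 2 ^ k * (m * (n - 1))" using q(2) card by (simp add: root_prod_degree_monic N_def)
    then obtain z where z: "z \<in> gauss" "poly (map_poly to_ac q) z = 0"
      using Suc.IH oddn by blast
    then have "z \<in># N" unfolding q(1)[symmetric] by (auto simp: poly_prod_mset prod_mset_zero_iff)
    then show ?thesis using z(1) finI by (auto simp: N_def)
  qed
  then obtain h where h: "h c \<in> I" "g c (h c) \<in> gauss" for c by metis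
  \<comment> \<open>Pigeonhole: \<open>h\<close> sends all natural numbers into the finite set
    \<open>I\<close>.\<close>
  have "\<not> inj h"
    using h(1) inj_on_finite[OF _ _ finI, of h UNIV] by auto
  then obtain c d where cd: "c \<noteq> d" "h c = h d" by (auto simp: inj_def)
  obtain i j where ij: "h c = (i, j)" "i < n" "j < n" using h(1)[of c] by (auto simp: I_def)
  let ?x = "xs ! i" and ?y = "xs ! j"
  have g1: "(?x + of_nat c) * (?y + of_nat c) \<in> gauss" "(?x + of_nat d) * (?y + of_nat d) \<in> gauss"
    using h(2)[of c] h(2)[of d] ij cd by (auto simp: g_def)
  have nat_g: "of_nat l \<in> gauss" for l
    using range_to_ac_subset_gauss range_to_ac_of_nat by blast
  have s: "?x + ?y \<in> gauss"
  proof -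
    have ne: "of_nat c - of_nat d \<noteq> (0 :: 'a alg_closure)" using cd by simp
    \<comment> \<open>Subtracting the two products cancels \<open>?x * ?y\<close> and leaves an
      equation linear in \<open>?x + ?y\<close>.\<close>
    have "((?x + of_nat c) * (?y + of_nat c) - (?x + of_nat d) * (?y + of_nat d)) -
        (of_nat c * of_nat c - of_nat d * of_nat d) = (?x + ?y) * (of_nat c - of_nat d)"
      by (simp add: algebra_simps)
    moreover have "((?x + of_nat c) * (?y + of_nat c) - (?x + of_nat d) * (?y + of_nat d)) -
        (of_nat c * of_nat c - of_nat d * of_nat d) \<in> gauss"
      by (intro gauss_diff g1 gauss_mult[OF nat_g nat_g])
    ultimately have "(?x + ?y) * (of_nat c - of_nat d) / (of_nat c - of_nat d) \<in> gauss"
      by (intro gauss_divide range_to_ac_intros) auto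
    then show ?thesis using ne by simp
  qed
  have "(?x + of_nat c) * (?y + of_nat c) - (of_nat c * (?x + ?y) + of_nat c * of_nat c) = ?x * ?y"
    by (simp add: algebra_simps)
  moreover have "(?x + of_nat c) * (?y + of_nat c) - (of_nat c * (?x + ?y) + of_nat c * of_nat c) \<in> gauss"
    by (intro gauss_diff gauss_add g1 gauss_mult[OF nat_g s] gauss_mult[OF nat_g nat_g])
  ultimately have "?x * ?y \<in> gauss" by simp
  then have "?x \<in> gauss" using gauss_quadratic[OF rcf s] by simp
  moreover have "?x \<in># M" using ij xs len by (metis nth_mem set_mset_mset)
  then have "poly P ?x = 0" by (subst M(2)) (auto simp: poly_prod_mset prod_mset_zero_iff)
  ultimately show ?case unfolding P_def by blast
qed

lemma exists_gauss_root:
  fixes p :: "'a::linordered_field poly"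
  assumes rcf: "real_closed_field TYPE('a)" and "degree p > 0"
  shows "\<exists>z\<in>gauss. poly (map_poly to_ac p) z = 0"
proof -
  obtain m where "degree p = 2 ^ multiplicity 2 (degree p) * m" "\<not> 2 dvd m"
    using multiplicity_decompose'[of "degree p" 2] assms(2) by auto
  then show ?thesis using exists_gauss_root_aux[OF rcf] by blast
qed

text \<open>The root in \<open>gauss\<close> lies in the base field by hypothesis, and its linear
  factor is split off. Roots of the quotient are roots of \<open>p\<close>, so the hypothesis is
  inherited.\<close>

lemma splits_if_gauss_roots_real:
  fixes p :: "'a::linordered_field poly"
  assumes rcf: "real_closed_field TYPE('a)" and "p \<noteq> 0"
    and "\<And>a b. poly (map_poly to_ac p) (to_ac a + to_ac b * ac_i) = 0 \<Longrightarrow> b = 0"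
  shows "\<exists>M. p = smult (lead_coeff p) (\<Prod>x\<in>#M. [:- x, 1:])"
  using assms(2,3)
proof (induction "degree p" arbitrary: p)
  case 0
  then show ?case by (intro exI[of _ "{#}"]) (auto elim: degree_eq_zeroE)
next
  case (Suc n)
  have hom: "poly (map_poly to_ac q) (to_ac a) = to_ac (poly q a)" for q :: "'a poly" and a
    by (induction q) (auto simp: map_poly_pCons)
  obtain z where z: "z \<in> gauss" "poly (map_poly to_ac p) z = 0"
    using exists_gauss_root[OF rcf, of p] Suc.hyps by auto
  then obtain a where a: "z = to_ac a" using Suc.prems(2) by (metis gaussE to_ac_0 mult_zero_left add.right_neutral)
  then have "poly p a = 0" using z hom by (metis to_ac_eq_0_iff)
  then obtain q where q: "p = [:- a, 1:] * q" by (metis dvdE poly_eq_0_iff_dvd)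
  have "q \<noteq> 0" using q Suc.prems by auto
  then have deg: "n = degree q" using Suc.hyps(2) q by (simp add: degree_mult_eq del: mult_pCons_left)
  have lc: "lead_coeff p = lead_coeff q" using q by (simp add: lead_coeff_mult del: mult_pCons_left)
  have mp: "map_poly to_ac p = [:- to_ac a, 1:] * map_poly to_ac q"
  proof (rule poly_eqI)
    fix k show "coeff (map_poly to_ac p) k = coeff ([:- to_ac a, 1:] * map_poly to_ac q) k"
      unfolding q by (cases k) (simp_all add: coeff_map_poly)
  qed
  have "b = 0" if "poly (map_poly to_ac q) (to_ac a' + to_ac b * ac_i) = 0" for a' b
    using Suc.prems(2)[of a' b] that unfolding mp by simp
  then obtain M where "q = smult (lead_coeff q) (\<Prod>x\<in>#M. [:- x, 1:])"
    using Suc.hyps(1)[OF deg \<open>q \<noteq> 0\<close>] by blast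
  then have "p = smult (lead_coeff p) (\<Prod>x\<in>#add_mset a M. [:- x, 1:])"
    using q lc by (simp del: mult_pCons_left) (metis mult_smult_right)
  then show ?case by blast
qed


section \<open>Eigenvalues of symmetric and positive definite matrices\<close>

lemma scalar_prod_self_pos:
  fixes v :: "'a::linordered_field vec"
  assumes "v \<in> carrier_vec n"
  shows "0 \<le> v \<bullet> v" "v \<noteq> 0\<^sub>v n \<Longrightarrow> 0 < v \<bullet> v"
proof -
  show "0 \<le> v \<bullet> v" by (auto simp: scalar_prod_def intro!: sum_nonneg)
  assume "v \<noteq> 0\<^sub>v n"
  then obtain i where i: "i < n" "v $ i \<noteq> 0" using assms by (metis eq_vecI carrier_vecD index_zero_vec)
  then show "0 < v \<bullet> v" using assms
    by (auto simp: scalar_prod_def zero_less_mult_iff intro!: sum_pos2[of _ i])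
qed

lemma symmetric_scalar_prod:
  fixes A :: "'a::comm_semiring_0 mat"
  assumes "A \<in> carrier_mat n n" "A\<^sup>T = A" "x \<in> carrier_vec n" "y \<in> carrier_vec n"
  shows "x \<bullet> (A *\<^sub>v y) = (A *\<^sub>v x) \<bullet> y"
  using transpose_vec_mult_scalar[OF assms(1,4,3)] assms(2) by simp

text \<open>If \<open>a + bi\<close> is an eigenvalue then \<open>(A - a)\<^sup>2 + b\<^sup>2\<close> is singular already over the real closed
  field, whereas its quadratic form is at least \<open>b\<^sup>2\<close> times the norm square.\<close>
lemma symmetric_gauss_eigenvalue_real:
  fixes A :: "'a::linordered_field mat"
  assumes A: "A \<in> carrier_mat n n" and sym: "A\<^sup>T = A"
    and root: "poly (map_poly to_ac (char_poly A)) (to_ac a + to_ac b * ac_i) = 0"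
  shows "b = 0"
proof (rule ccontr)
  assume b: "b \<noteq> 0"
  interpret h: inj_comm_ring_hom "to_ac :: 'a \<Rightarrow> 'a alg_closure" by standard auto
  define S where "S = A + (- a) \<cdot>\<^sub>m 1\<^sub>m n"
  define N where "N = S * S + (b * b) \<cdot>\<^sub>m 1\<^sub>m n"
  define S' where "S' = map_mat to_ac S"
  define \<beta> where "\<beta> = to_ac b * ac_i"
  \<comment> \<open>\<open>C1\<close> is \<open>A - (a + bi)\<close> over the algebraic closure and
    \<open>C2\<close> its conjugate, so their product is the image of \<open>N\<close>, a matrix
    over the base field.\<close>
  define C1 where "C1 = S' + (- \<beta>) \<cdot>\<^sub>m 1\<^sub>m n"
  define C2 where "C2 = S' + \<beta> \<cdot>\<^sub>m 1\<^sub>m n"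
  have S: "S \<in> carrier_mat n n" and S': "S' \<in> carrier_mat n n" and N: "N \<in> carrier_mat n n"
    and C: "C1 \<in> carrier_mat n n" "C2 \<in> carrier_mat n n"
    using A by (auto simp: S_def S'_def N_def C1_def C2_def)
  have \<beta>: "\<beta> * \<beta> = - to_ac (b * b)"
  proof -
    have "\<beta> * \<beta> = to_ac (b * b) * (ac_i * ac_i)" by (simp add: \<beta>_def)
    then show ?thesis by (simp add: ac_i_square)
  qed
  have "C1 * C2 = S' * C2 + ((- \<beta>) \<cdot>\<^sub>m 1\<^sub>m n) * C2"
    unfolding C1_def by (rule add_mult_distrib_mat[OF S' _ C(2)]) simp
  also have "S' * C2 = S' * S' + \<beta> \<cdot>\<^sub>m S'"
    unfolding C2_def using S' by (subst mult_add_distrib_mat[OF S' S']) (auto simp: mult_smult_distrib[OF S'])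
  also have "((- \<beta>) \<cdot>\<^sub>m 1\<^sub>m n) * C2 = (- \<beta>) \<cdot>\<^sub>m C2"
    using C(2) by (subst mult_smult_assoc_mat[of _ n n]) auto
  also have "(S' * S' + \<beta> \<cdot>\<^sub>m S') + (- \<beta>) \<cdot>\<^sub>m C2 = map_mat to_ac N"
  proof (rule eq_matI)
    fix i j assume "i < dim_row (map_mat to_ac N)" "j < dim_col (map_mat to_ac N)"
    then have ij: "i < n" "j < n" using N by auto
    have SS: "map_mat to_ac (S * S) = S' * S'" unfolding S'_def by (rule h.mat_hom_mult[OF S S])
    have "to_ac ((S * S) $$ (i, j)) = (S' * S') $$ (i, j)"
      unfolding SS[symmetric] using ij S by simp
    then have Nij: "map_mat to_ac N $$ (i, j) = (S' * S') $$ (i, j) - (\<beta> * \<beta>) * (if i = j then 1 else 0)"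
      using ij S by (simp add: N_def \<beta>)
    show "(S' * S' + \<beta> \<cdot>\<^sub>m S' + (- \<beta>) \<cdot>\<^sub>m C2) $$ (i, j) = map_mat to_ac N $$ (i, j)"
      unfolding Nij using ij S' C by (simp add: C2_def algebra_simps del: index_mult_mat(1))
  qed (use S' N C in auto)
  finally have prod: "C1 * C2 = map_mat to_ac N" .
  have A': "map_mat to_ac A \<in> carrier_mat n n" using A by simp
  have "char_matrix (map_mat to_ac A) (to_ac a + \<beta>) = C1"
    using A by (intro eq_matI) (auto simp: char_matrix_def C1_def S'_def S_def)
  moreover have "eigenvalue (map_mat to_ac A) (to_ac a + \<beta>)"
    unfolding eigenvalue_root_char_poly[OF A'] h.char_poly_hom[OF A] using root by (simp add: \<beta>_def)
  ultimately have "det C1 = 0" using eigenvalue_det[OF A'] by simp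
  then have "to_ac (det N) = 0"
    unfolding h.hom_det[symmetric] prod[symmetric] det_mult[OF C] by simp
  then have "det N = 0" by simp
  \<comment> \<open>The kernel vector is taken over the ordered field itself, where squares are
    nonnegative.\<close>
  then obtain v where v: "v \<in> carrier_vec n" "v \<noteq> 0\<^sub>v n" "N *\<^sub>v v = 0\<^sub>v n"
    using det_0_iff_vec_prod_zero_field[OF N] by blast
  have symS: "S\<^sup>T = S"
  proof (rule eq_matI)
    fix i j assume "i < dim_row S" "j < dim_col S"
    then have ij: "i < n" "j < n" using S by auto
    have "A $$ (j, i) = A $$ (i, j)" using sym A ij by (metis carrier_matD index_transpose_mat(1))
    then show "S\<^sup>T $$ (i, j) = S $$ (i, j)" using ij A S by (auto simp: S_def)
  qed (use S in auto)
  have Sv: "S *\<^sub>v v \<in> carrier_vec n" using S v(1) by simp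
  have one: "((b * b) \<cdot>\<^sub>m 1\<^sub>m n) *\<^sub>v v = (b * b) \<cdot>\<^sub>v v"
  proof (rule eq_vecI)
    fix i assume "i < dim_vec ((b * b) \<cdot>\<^sub>v v)"
    then have i: "i < n" using v(1) by simp
    have "(((b * b) \<cdot>\<^sub>m 1\<^sub>m n) *\<^sub>v v) $ i = (\<Sum>k = 0..<n. b * b * (if k = i then 1 else 0) * v $ k)"
      using i v(1) by (simp add: scalar_prod_def)
    also have "\<dots> = (\<Sum>k = 0..<n. if k = i then b * b * v $ k else 0)"
      by (rule sum.cong) auto
    finally show "(((b * b) \<cdot>\<^sub>m 1\<^sub>m n) *\<^sub>v v) $ i = ((b * b) \<cdot>\<^sub>v v) $ i"
      using i v(1) by simp
  qed (use v(1) in simp)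
  have "0 = v \<bullet> (N *\<^sub>v v)" using v by simp
  also have "N *\<^sub>v v = S *\<^sub>v (S *\<^sub>v v) + (b * b) \<cdot>\<^sub>v v"
    unfolding N_def one[symmetric] using S v(1)
    by (subst add_mult_distrib_mat_vec[of _ n n]) auto
  also have "v \<bullet> \<dots> = (S *\<^sub>v v) \<bullet> (S *\<^sub>v v) + (b * b) * (v \<bullet> v)"
    using S v(1) Sv symmetric_scalar_prod[OF S symS v(1) Sv]
    by (subst scalar_prod_add_distrib[of _ n]) auto
  finally have "(S *\<^sub>v v) \<bullet> (S *\<^sub>v v) + (b * b) * (v \<bullet> v) = 0" by simp
  moreover have "0 < (b * b) * (v \<bullet> v)"
    using b scalar_prod_self_pos(2)[OF v(1,2)] by (auto simp: zero_less_mult_iff)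
  moreover have "0 \<le> (S *\<^sub>v v) \<bullet> (S *\<^sub>v v)" by (rule scalar_prod_self_pos(1)[OF Sv])
  ultimately show False by linarith
qed

theorem symmetric_char_poly_splits:
  fixes A :: "'a::linordered_field mat"
  assumes rcf: "real_closed_field TYPE('a)" and A: "A \<in> carrier_mat n n" and sym: "A\<^sup>T = A"
  shows "\<exists>M. char_poly A = (\<Prod>x\<in>#M. [:- x, 1:])"
proof -
  have m: "lead_coeff (char_poly A) = 1" using degree_monic_char_poly[OF A] by simp
  then have "char_poly A \<noteq> 0" by auto
  with m show ?thesis
    using splits_if_gauss_roots_real[OF rcf, of "char_poly A"] symmetric_gauss_eigenvalue_real[OF A sym]
    by (metis smult_1_left)
qed

lemma pos_def_root_pos:
  fixes A :: "'a::linordered_field mat"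
  assumes pd: "pos_def_mat n A" and root: "poly (char_poly A) x = 0"
  shows "x > 0"
proof -
  have A: "A \<in> carrier_mat n n" using pd by (simp add: pos_def_mat_def)
  have "eigenvalue A x" using root eigenvalue_root_char_poly[OF A] by simp
  then obtain v where v: "v \<in> carrier_vec n" "v \<noteq> 0\<^sub>v n" "A *\<^sub>v v = x \<cdot>\<^sub>v v"
    using A by (auto simp: eigenvalue_def eigenvector_def)
  have "0 < v \<bullet> (A *\<^sub>v v)" using pd v(1,2) by (simp add: pos_def_mat_def)
  also have "\<dots> = x * (v \<bullet> v)" unfolding v(3) using v(1) by simp
  finally have "0 < x * (v \<bullet> v)" .
  then show ?thesis using scalar_prod_self_pos(1)[OF v(1)] by (auto simp: zero_less_mult_iff)
qed

section \<open>Lifting tropical identities along the signed valuation\<close>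

text \<open>The valuation of zero is \<open>None\<close>, on which \<open>the\<close> is
  unspecified; the explicit disjunct places zero below every bound, here and in
  \<open>val_less\<close>.\<close>

definition val_le :: "('a::linordered_field \<Rightarrow> 'g::linordered_ab_group_add option) \<Rightarrow> 'a \<Rightarrow> 'g \<Rightarrow> bool" where
  "val_le v x g \<longleftrightarrow> x = 0 \<or> the (v x) \<le> g"

definition val_less :: "('a::linordered_field \<Rightarrow> 'g::linordered_ab_group_add option) \<Rightarrow> 'a \<Rightarrow> 'g \<Rightarrow> bool" where
  "val_less v x g \<longleftrightarrow> x = 0 \<or> the (v x) < g"

text \<open>The field element \<open>x\<close> is one of the values represented by the tropical element, a balanced
  element standing for everything of at most its modulus. In contrast to \<open>signed_val\<close> itself, this
  relation is compatible with addition.\<close>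
fun lifts :: "('a::linordered_field \<Rightarrow> 'g::linordered_ab_group_add option) \<Rightarrow> 'a \<Rightarrow> 'g smax \<Rightarrow> bool" where
  "lifts v x SZero \<longleftrightarrow> x = 0"
| "lifts v x (SPos g) \<longleftrightarrow> x > 0 \<and> the (v x) = g"
| "lifts v x (SNeg g) \<longleftrightarrow> x < 0 \<and> the (v x) = g"
| "lifts v x (SBal g) \<longleftrightarrow> val_le v x g"

lemma lifts_signed_val: "lifts v x (signed_val v x)"
  by (auto simp: signed_val_def)

lemma lifts_signedD: "lifts v x s \<Longrightarrow> smax_signed s \<Longrightarrow> signed_val v x = s"
  by (cases s) (auto simp: signed_val_def smax_signed_def)

definition poly_lifts :: "('a::linordered_field \<Rightarrow> 'g::linordered_ab_group_add option) \<Rightarrow> 'a poly \<Rightarrow> 'g smax poly \<Rightarrow> bool" where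
  "poly_lifts v p P \<longleftrightarrow> (\<forall>k. lifts v (coeff p k) (coeff P k))"

section \<open>Compatibility of lifting with ring operations and characteristic polynomials\<close>

context
  fixes v :: "'a::linordered_field \<Rightarrow> 'g::linordered_ab_group_add option"
  assumes v: "convex_valuation v"
begin

private abbreviation "w x \<equiv> the (v x)"

private lemma w_mult: "x \<noteq> 0 \<Longrightarrow> y \<noteq> 0 \<Longrightarrow> w (x * y) = w x + w y"
  using v by (simp add: convex_valuation_def)

private lemma w_add: "x + y \<noteq> 0 \<Longrightarrow> x \<noteq> 0 \<Longrightarrow> y \<noteq> 0 \<Longrightarrow> w (x + y) \<le> max (w x) (w y)"
  using v unfolding convex_valuation_def by blast

private lemma w_mono: "x \<noteq> 0 \<Longrightarrow> \<bar>x\<bar> \<le> \<bar>y\<bar> \<Longrightarrow> w x \<le> w y"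
  using v unfolding convex_valuation_def by blast

private lemma w_minus: "w (- x) = w x"
  using w_mono[of x "- x"] w_mono[of "- x" x] by (cases "x = 0") auto

private lemma w_1: "w 1 = 0"
  using w_mult[of 1 1] by simp

lemma val_le_add: "val_le v x g \<Longrightarrow> val_le v y g \<Longrightarrow> val_le v (x + y) g"
  using w_add[of x y] by (fastforce simp: val_le_def le_max_iff_disj intro: order_trans)

text \<open>By convexity a smaller valuation forces a smaller absolute value, so the sign of
  \<open>x\<close> prevails. The ultrametric inequality for \<open>x = (x + y) + (- y)\<close> shows
  that the valuation does not drop.\<close>

lemma val_less_add_pos:
  assumes x: "x > 0" and y: "val_less v y (w x)"
  shows "x + y > 0 \<and> w (x + y) = w x"
proof (cases "y = 0")
  case False
  then have lt: "w y < w x" using y by (simp add: val_less_def)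
  have "\<bar>y\<bar> < \<bar>x\<bar>" using w_mono[of x y] lt x by (metis leD leI less_irrefl)
  then have pos: "x + y > 0" using x by auto
  have "w (x + y) \<le> w x" using w_add[of x y] pos x False lt by (auto simp: max_def split: if_splits)
  moreover have "w x \<le> max (w (x + y)) (w (- y))" using w_add[of "x + y" "- y"] pos x False by simp
  ultimately show ?thesis using pos lt by (auto simp: w_minus max_def split: if_splits)
qed (use x in auto)

lemma val_less_add_neg:
  assumes x: "x < 0" and y: "val_less v y (w x)"
  shows "x + y < 0 \<and> w (x + y) = w x"
proof -
  have "- x + - y > 0 \<and> w (- x + - y) = w (- x)"
    by (rule val_less_add_pos) (use assms in \<open>auto simp: val_less_def w_minus\<close>)
  then show ?thesis using w_minus[of "x + y"] by (simp add: w_minus)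
qed

lemma lifts_add_dominated: "lifts v x s \<Longrightarrow> s \<noteq> SZero \<Longrightarrow> val_less v y (smod s) \<Longrightarrow> lifts v (x + y) s"
  using val_less_add_pos[of x y] val_less_add_neg[of x y] val_le_add[of x "smod s" y]
  by (cases s) (auto simp: val_le_def val_less_def order.strict_implies_order)

lemma lifts_val_le: "lifts v x s \<Longrightarrow> s \<noteq> SZero \<Longrightarrow> val_le v x (smod s)"
  by (cases s) (auto simp: val_le_def)

private lemma w_add_same_sign: "x > 0 \<Longrightarrow> y > 0 \<Longrightarrow> w x = w y \<Longrightarrow> w (x + y) = w x"
  using w_add[of x y] w_mono[of x "x + y"] by auto

text \<open>With different moduli the larger term decides. With equal moduli, distinct summands give
  a balanced element, for which an upper bound suffices, and equal signed summands have no
  cancellation by \<open>w_add_same_sign\<close>.\<close>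

lemma lifts_add:
  assumes "lifts v x s" "lifts v y t"
  shows "lifts v (x + y) (s + t)"
proof -
  consider "s = SZero" | "t = SZero" | "s \<noteq> SZero" "t \<noteq> SZero" "smod t < smod s"
    | "s \<noteq> SZero" "t \<noteq> SZero" "smod s < smod t" | "s \<noteq> SZero" "t \<noteq> SZero" "smod s = smod t"
    by (meson linorder_neqE)
  then show ?thesis
  proof cases
    case 1
    then show ?thesis using assms by (auto simp: plus_smax_def)
  next
    case 2
    then show ?thesis using assms by (cases s) (auto simp: plus_smax_def)
  next
    case 3
    have "s + t = s" by (rule smax_dom_absorb) (use 3 in \<open>auto simp: smax_dom_def\<close>)
    moreover have "val_less v y (smod s)"
      using lifts_val_le[OF assms(2) 3(2)] 3(3) by (auto simp: val_le_def val_less_def)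
    ultimately show ?thesis using lifts_add_dominated[OF assms(1) 3(1)] by simp
  next
    case 4
    have "t + s = t" by (rule smax_dom_absorb) (use 4 in \<open>auto simp: smax_dom_def\<close>)
    moreover have "val_less v x (smod t)"
      using lifts_val_le[OF assms(1) 4(1)] 4(3) by (auto simp: val_le_def val_less_def)
    ultimately show ?thesis using lifts_add_dominated[OF assms(2) 4(2), of x] by (simp add: add.commute)
  next
    case 5
    have bal: "lifts v (x + y) (SBal (smod s))"
      using val_le_add[of x "smod s" y] lifts_val_le[OF assms(1) 5(1)] lifts_val_le[OF assms(2) 5(2)] 5(3)
      by simp
    show ?thesis
    proof (cases "s = t")
      case False
      then have "s + t = SBal (smod s)"
        using 5 by (cases s; cases t) (auto simp: plus_smax_def)
      then show ?thesis using bal by simp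
    next
      case True
      then have st: "s + t = s" by (cases s) (auto simp: plus_smax_def)
      show ?thesis
      proof (cases s)
        case (SPos g)
        then show ?thesis using assms True st w_add_same_sign[of x y] by auto
      next
        case (SNeg g)
        then have "w (- x + - y) = g"
          using assms True w_add_same_sign[of "- x" "- y"] by (simp add: w_minus)
        then have "w (x + y) = g" using w_minus[of "x + y"] by simp
        then show ?thesis using assms True st SNeg by auto
      qed (use 5 bal st in auto)
    qed
  qed
qed

lemma lifts_mult:
  assumes "lifts v x s" "lifts v y t"
  shows "lifts v (x * y) (s * t)"
proof (cases "x = 0 \<or> y = 0")
  case True
  then show ?thesis using assms
    by (cases s; cases t) (auto simp: times_smax_def val_le_def)
next
  case False
  then show ?thesis using assms
    by (cases s; cases t)
      (auto simp: times_smax_def val_le_def w_mult mult_pos_neg mult_neg_pos mult_neg_neg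
        intro: add_mono)
qed

lemma lifts_uminus: "lifts v x s \<Longrightarrow> lifts v (- x) (smax_neg s)"
  by (cases s) (auto simp: val_le_def w_minus)

lemma lifts_0: "lifts v 0 0" and lifts_1: "lifts v 1 1"
  by (auto simp: smax_ops w_1)

lemma lifts_sum: "(\<And>i. i \<in> S \<Longrightarrow> lifts v (f i) (F i)) \<Longrightarrow> lifts v (sum f S) (sum F S)"
  by (induction S rule: infinite_finite_induct) (auto intro: lifts_add lifts_0)

lemma poly_lifts_add: "poly_lifts v p P \<Longrightarrow> poly_lifts v q Q \<Longrightarrow> poly_lifts v (p + q) (P + Q)"
  by (auto simp: poly_lifts_def intro: lifts_add)

lemma poly_lifts_mult: "poly_lifts v p P \<Longrightarrow> poly_lifts v q Q \<Longrightarrow> poly_lifts v (p * q) (P * Q)"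
  by (auto simp: poly_lifts_def coeff_mult intro!: lifts_sum lifts_mult)

lemma poly_lifts_0: "poly_lifts v 0 0"
  by (simp add: poly_lifts_def lifts_0)

lemma poly_lifts_pCons: "lifts v a s \<Longrightarrow> poly_lifts v p P \<Longrightarrow> poly_lifts v (pCons a p) (pCons s P)"
  by (auto simp: poly_lifts_def coeff_pCons split: nat.split)

lemma poly_lifts_1: "poly_lifts v 1 1"
  unfolding one_pCons by (intro poly_lifts_pCons lifts_1 poly_lifts_0)

lemma poly_lifts_sum: "(\<And>i. i \<in> S \<Longrightarrow> poly_lifts v (f i) (F i)) \<Longrightarrow> poly_lifts v (sum f S) (sum F S)"
  by (induction S rule: infinite_finite_induct) (auto intro: poly_lifts_add poly_lifts_0)

lemma poly_lifts_prod: "(\<And>i. i \<in> S \<Longrightarrow> poly_lifts v (f i) (F i)) \<Longrightarrow> poly_lifts v (prod f S) (prod F S)"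
  by (induction S rule: infinite_finite_induct) (auto intro: poly_lifts_mult poly_lifts_1)

lemma poly_lifts_root_prod:
  "poly_lifts v (\<Prod>x\<in>#M. [:- x, 1:]) (smax_root_prod (image_mset (signed_val v) M))"
proof (induction M)
  case (add x M)
  have "poly_lifts v [:- x, 1:] [:smax_neg (signed_val v x), 1:]"
    by (intro poly_lifts_pCons lifts_uminus lifts_signed_val lifts_1 poly_lifts_0)
  with add show ?case by (auto intro: poly_lifts_mult simp del: mult_pCons_left)
qed (simp add: poly_lifts_1)

text \<open>The Leibniz expansion and its tropical analogue have the same shape, so lifting passes
  through term by term; possible cancellation in the field is accounted for by balanced
  coefficients.\<close>

lemma poly_lifts_char_poly:
  assumes A: "A \<in> carrier_mat n n"
  shows "poly_lifts v (char_poly A) (smax_char_poly (map_mat (signed_val v) A))"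
proof -
  have sgn: "poly_lifts v (signof p) (if evenperm p then 1 else smax_poly_neg 1)" for p :: "nat \<Rightarrow> nat"
  proof (cases "evenperm p")
    case True
    then show ?thesis by (simp add: sign_def poly_lifts_1)
  next
    case False
    have "poly_lifts v [:- 1:] [:smax_neg 1:]"
      by (intro poly_lifts_pCons lifts_uminus lifts_1 poly_lifts_0)
    then show ?thesis using False by (simp add: sign_def smax_poly_neg_def one_pCons)
  qed
  have entry: "poly_lifts v (char_poly_matrix A $$ (i, j))
      ((if i = j then [:0, 1:] else 0) + [:smax_neg (map_mat (signed_val v) A $$ (i, j)):])"
    if ij: "i < n" "j < n" for i j
  proof -
    have "char_poly_matrix A $$ (i, j) = (if i = j then [:0, 1:] else 0) + [:- (A $$ (i, j)):]"
      using A ij by (simp add: char_poly_matrix_def)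
    moreover have "poly_lifts v (if i = j then [:0, 1:] else 0) (if i = j then [:0, 1:] else 0)"
      by (auto intro!: poly_lifts_pCons lifts_0 lifts_1 poly_lifts_0)
    moreover have "poly_lifts v [:- (A $$ (i, j)):] [:smax_neg (map_mat (signed_val v) A $$ (i, j)):]"
      using A ij by (auto intro!: poly_lifts_pCons lifts_uminus lifts_signed_val poly_lifts_0)
    ultimately show ?thesis by (simp only: poly_lifts_add)
  qed
  have "char_poly A = (\<Sum>p\<in>{p. p permutes {..<n}}. signof p * (\<Prod>i<n. char_poly_matrix A $$ (i, p i)))"
    unfolding char_poly_def using A by (subst det_def'[of _ n]) (auto simp: atLeast0LessThan)
  moreover have "smax_char_poly (map_mat (signed_val v) A) = (\<Sum>p\<in>{p. p permutes {..<n}}.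
      (if evenperm p then 1 else smax_poly_neg 1) *
      (\<Prod>i<n. (if i = p i then [:0, 1:] else 0) + [:smax_neg (map_mat (signed_val v) A $$ (i, p i)):]))"
    using A by (simp add: smax_char_poly_def sym_det_def)
  moreover have "poly_lifts v (\<Sum>p\<in>{p. p permutes {..<n}}. signof p * (\<Prod>i<n. char_poly_matrix A $$ (i, p i)))
      (\<Sum>p\<in>{p. p permutes {..<n}}. (if evenperm p then 1 else smax_poly_neg 1) *
      (\<Prod>i<n. (if i = p i then [:0, 1:] else 0) + [:smax_neg (map_mat (signed_val v) A $$ (i, p i)):]))"
  proof (intro poly_lifts_sum poly_lifts_mult sgn poly_lifts_prod entry)
    fix p i assume "p \<in> {p. p permutes {..<n}}" "i \<in> {..<n}"
    then show "i < n" "p i < n" using permutes_in_image by fastforce+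
  qed
  ultimately show ?thesis by simp
qed

end

text \<open>Only balanced coefficients are ambiguous: signed ones must be the signed valuations of
  the coefficients of \<open>p\<close>.\<close>

lemma poly_lifts_signed_unique:
  assumes "poly_lifts v p P" "poly_lifts v p Q" "smax_poly_signed P" "smax_poly_signed Q"
  shows "P = Q"
  using assms by (intro poly_eqI) (metis lifts_signedD poly_lifts_def smax_poly_signed_def)

lemma proots_root_prod: "proots (\<Prod>x\<in>#M. [:- x, 1:]) = (M :: 'a::idom multiset)"
proof (induction M)
  case (add x M)
  have "(\<Prod>x\<in>#M. [:- x, 1:]) \<noteq> 0" by (auto simp: prod_mset_zero_iff)
  then have "proots ([:- x, 1:] * (\<Prod>x\<in>#M. [:- x, 1:])) = add_mset x M"
    using add by (subst proots_mult) (auto simp del: mult_pCons_left)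
  then show ?case by (simp del: mult_pCons_left)
qed simp

theorem theorem6p3:
  fixes v :: "'a::linordered_field \<Rightarrow> 'g::linordered_ab_group_add option"
    and A :: "'g smax mat" and AA :: "'a mat" and n :: nat
  assumes "divisible_group TYPE('g)"
    and "real_closed_field TYPE('a)"
    and "convex_valuation v"
    and "smax_TPD n A"
    and "pos_def_mat n AA"
    and "map_mat (signed_val v) AA = A"
  shows "\<forall>\<gamma>. count (image_mset (signed_val v) (proots (char_poly AA))) \<gamma> = smax_alg_eig_mult A \<gamma>
       \<and> count (image_mset (signed_val v) (proots (char_poly AA))) \<gamma>
           = count (mset (map (\<lambda>i. A $$ (i, i)) [0..<n])) \<gamma>"
proof -
  define D where "D = mset (map (\<lambda>i. A $$ (i, i)) [0..<n])"
  note TPD = smax_alg_eig_mult_TPD[OF assms(1,4), folded D_def]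
  have AA: "AA \<in> carrier_mat n n" "AA\<^sup>T = AA" using assms(5) by (auto simp: pos_def_mat_def)
  obtain M where M: "char_poly AA = (\<Prod>x\<in>#M. [:- x, 1:])"
    using symmetric_char_poly_splits[OF assms(2) AA] by blast
  have roots: "proots (char_poly AA) = M" unfolding M by (rule proots_root_prod)
  have "x > 0" if "x \<in># M" for x
    using that by (intro pos_def_root_pos[OF assms(5)]) (auto simp: M poly_prod_mset prod_mset_zero_iff)
  then have pos: "\<forall>s\<in>#image_mset (signed_val v) M. \<exists>g. s = SPos g"
    by (auto simp: signed_val_def)
  \<comment> \<open>One polynomial is lifted in two ways, first from its roots and then from the
    matrix entries.\<close>
  have "poly_lifts v (char_poly AA) (smax_root_prod (image_mset (signed_val v) M))"
    unfolding M by (rule poly_lifts_root_prod[OF assms(3)])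
  moreover have "poly_lifts v (char_poly AA) (smax_root_prod D)"
    using poly_lifts_char_poly[OF assms(3) AA(1)] by (simp only: assms(6) TPD(2))
  ultimately have "smax_root_prod (image_mset (signed_val v) M) = smax_root_prod D"
    by (rule poly_lifts_signed_unique) (intro smax_root_prod_signed pos TPD(1))+
  then have "image_mset (signed_val v) M = D"
    by (rule smax_root_prod_inject[OF pos TPD(1)])
  then show ?thesis unfolding roots D_def[symmetric] by (simp add: TPD(3))
qed

end
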